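(* Let $Q\in\mathbb{F}_q[T]$ be nonzero and let $0<\varepsilon<1$. Then for every integer $n\ge0$, \[\sum_{\substack{f\text{ monic}\\ \deg f=n}}\mathbb{V}[\tau(f;\circ,Q)]=A_Q\,(n+1)\,q^{n+1}+B_Q\,q^{n+1}+O\!\left(q^{n\varepsilon}(q^{1-\varepsilon}-1)^{-2}\right),\] where the implied constant depends only on $q$, $Q$ and $\varepsilon$, and \[A_Q=\frac{q-1}{q^2\Phi(Q)^2}\prod_{P\mid Q}\frac{1}{1+\frac{1}{|P|}}\sum_{\chi\neq\chi_0}|L(1,\chi)|^2,\] \[B_Q=\frac{\prod_{P\mid Q}(1+\frac{1}{|P|})^{-1}}{q^2\Phi(Q)^2}\left(\Big(\frac{q-1}{\log q}\sum_{P\mid Q}\frac{\log|P|}{|P|+1}+2\Big)\sum_{\chi\neq\chi_0}|L(1,\chi)|^2+\frac{2(q-1)}{\log q}\sum_{\chi\neq\chi_0}|L(1,\chi)|^2\,\mathrm{Re}\!\left(\frac{L'(1,\chi)}{L(1,\chi)}\right)\right).\]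
   Context: $q$ is a prime power, $|f|=q^{\deg f}$, $P$ runs over monic irreducible polynomials in $\mathbb{F}_q[T]$. $\Phi(Q)$ is the number of units of $\mathbb{F}_q[T]/(Q)$. Dirichlet characters $\chi$ mod $Q$ are homomorphisms $(\mathbb{F}_q[T]/(Q))^*\to\mathbb{C}^*$ extended by $0$ on polynomials not coprime to $Q$; $\chi_0$ is the principal one and $\sum_{\chi\ne\chi_0}$ runs over non-principal characters mod $Q$. For non-principal $\chi$, $L(s,\chi)=\sum_{f\text{ monic}}\chi(f)|f|^{-s}$ is a polynomial in $q^{-s}$ (hence entire in $s$), and $L'(1,\chi)$ is its derivative with respect to $s$ at $s=1$. For monic $f$, $\tau(f;Q)$ is the number of monic divisors of $f$ coprime to $Q$, $\tau(f;h,Q)$ is the number of monic divisors $d$ of $f$ with $d\equiv h\bmod Q$, and \[\mathbb{V}[\tau(f;\circ,Q)]=\frac{1}{\Phi(Q)}\sum_{h}\left(\tau(f;h,Q)-\frac{\tau(f;Q)}{\Phi(Q)}\right)^2,\] with $h$ running over a set of representatives of the reduced residue classes mod $Q$. *)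

theory Defs
  imports "HOL-Analysis.Analysis" "HOL-Computational_Algebra.Computational_Algebra"
    "HOL-Number_Theory.Cong"
begin

(* Throughout, F_q is a type of class {finite, field}, so that q = CARD('a); since
   any such type may be substituted, q ranges over all prime powers. *)

abbreviation is_monic :: "'a::{finite,field} poly \<Rightarrow> bool" where
  "is_monic f \<equiv> lead_coeff f = 1"

definition abs_poly :: "'a::{finite,field} poly \<Rightarrow> real" where
  "abs_poly f = real CARD('a) ^ degree f"

definition monic_prime_divisors :: "'a::{finite,field} poly \<Rightarrow> 'a poly set" where
  "monic_prime_divisors Q = {P. is_monic P \<and> irreducible P \<and> P dvd Q}"

(* The residue ring modulo Q (Q nonzero) is represented by the remainders h = h mod Q.
   If Q is a nonzero constant this is the zero ring, whose only element 0 = 1 is a unit,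
   so that Phi(Q) = 1. *)

definition residue_units :: "'a::{finite,field} poly \<Rightarrow> 'a poly set" where
  "residue_units Q = {h. h mod Q = h \<and> (\<exists>g. [h * g = 1] (mod Q))}"

definition Phi :: "'a::{finite,field} poly \<Rightarrow> nat" where
  "Phi Q = card (residue_units Q)"

definition reduced_residues :: "'a::{finite,field} poly \<Rightarrow> 'a poly set" where
  "reduced_residues Q = {h. h mod Q = h \<and> coprime h Q}"

(* A homomorphism from the unit group modulo Q to the nonzero complex numbers, viewed as a
   Q-periodic function on polynomials and extended by 0. *)

definition dirichlet_character ::
    "'a::{finite,field} poly \<Rightarrow> ('a poly \<Rightarrow> complex) \<Rightarrow> bool" where
  "dirichlet_character Q chi \<longleftrightarrow>
     (\<forall>f g. [f = g] (mod Q) \<longrightarrow> chi f = chi g) \<and>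
     (\<forall>f g. coprime f Q \<longrightarrow> coprime g Q \<longrightarrow> chi (f * g) = chi f * chi g) \<and>
     (\<forall>f. coprime f Q \<longrightarrow> chi f \<noteq> 0) \<and>
     (\<forall>f. \<not> coprime f Q \<longrightarrow> chi f = 0)"

definition principal_character :: "'a::{finite,field} poly \<Rightarrow> 'a poly \<Rightarrow> complex" where
  "principal_character Q f = (if coprime f Q then 1 else 0)"

definition nonprincipal_characters ::
    "'a::{finite,field} poly \<Rightarrow> ('a poly \<Rightarrow> complex) set" where
  "nonprincipal_characters Q =
     {chi. dirichlet_character Q chi \<and> chi \<noteq> principal_character Q}"

(* The sum over monic f is ordered by degree. For non-principal characters the inner sum
   vanishes for n >= deg Q, so the series terminates for every complex s and is the
   polynomial in q^(-s) that continues the Dirichlet series (absolutely convergent only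
   for Re s > 1) to the whole plane. *)

definition L_function :: "('a::{finite,field} poly \<Rightarrow> complex) \<Rightarrow> complex \<Rightarrow> complex" where
  "L_function chi s =
     (\<Sum>n. \<Sum>f | is_monic f \<and> degree f = n. chi f * complex_of_real (abs_poly f) powr (- s))"

definition tau_coprime :: "'a::{finite,field} poly \<Rightarrow> 'a poly \<Rightarrow> nat" where
  "tau_coprime f Q = card {d. is_monic d \<and> d dvd f \<and> coprime d Q}"

definition tau_cong :: "'a::{finite,field} poly \<Rightarrow> 'a poly \<Rightarrow> 'a poly \<Rightarrow> nat" where
  "tau_cong f h Q = card {d. is_monic d \<and> d dvd f \<and> [d = h] (mod Q)}"

definition tau_variance :: "'a::{finite,field} poly \<Rightarrow> 'a poly \<Rightarrow> real" where
  "tau_variance f Q =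
     1 / real (Phi Q) *
       (\<Sum>h\<in>reduced_residues Q.
          (real (tau_cong f h Q) - real (tau_coprime f Q) / real (Phi Q))\<^sup>2)"

definition A_coeff :: "'a::{finite,field} poly \<Rightarrow> real" where
  "A_coeff Q =
     (let q = real CARD('a) in
      (q - 1) / (q\<^sup>2 * (real (Phi Q))\<^sup>2) *
      (\<Prod>P\<in>monic_prime_divisors Q. 1 / (1 + 1 / abs_poly P)) *
      (\<Sum>chi\<in>nonprincipal_characters Q. (cmod (L_function chi 1))\<^sup>2))"

definition B_coeff :: "'a::{finite,field} poly \<Rightarrow> real" where
  "B_coeff Q =
     (let q = real CARD('a) in
      (\<Prod>P\<in>monic_prime_divisors Q. inverse (1 + 1 / abs_poly P)) / (q\<^sup>2 * (real (Phi Q))\<^sup>2) *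
      (((q - 1) / ln q * (\<Sum>P\<in>monic_prime_divisors Q. ln (abs_poly P) / (abs_poly P + 1)) + 2) *
         (\<Sum>chi\<in>nonprincipal_characters Q. (cmod (L_function chi 1))\<^sup>2) +
       2 * (q - 1) / ln q *
         (\<Sum>chi\<in>nonprincipal_characters Q.
            (cmod (L_function chi 1))\<^sup>2 * Re (deriv (L_function chi) 1 / L_function chi 1))))"

end

theory Submission
  imports Defs "HOL-Algebra.Coset" "HOL-Algebra.FiniteProduct"
    "HOL-Complex_Analysis.Cauchy_Integral_Formula"
begin

text \<open>Character orthogonality turns the variance into the sum over \<open>\<chi> \<noteq> \<chi>\<^sub>0\<close> of
  \<open>|r(f)|\<^sup>2 / \<Phi>(Q)\<^sup>2\<close> with \<open>r(f) = \<Sum>\<^bsub>d | f\<^esub> \<chi>(d)\<close>. Writing a pair of divisors of \<open>f\<close> as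
  \<open>(g a, g b)\<close> with \<open>a, b\<close> coprime and \<open>f = g a b m\<close>, the generating series \<open>F(u)\<close> of \<open>|r(f)|\<^sup>2\<close>
  factors, and extracting gcds from the product \<open>L(u, \<chi>) L(u, \<chi>')\<close>, where \<open>\<chi>'\<close> is the conjugate
  of \<open>\<chi>\<close>, eliminates the coprime pairs. In the variable \<open>u = q\<^sup>-\<^sup>s\<close> the outcome is
  \<open>F(u) (1 - q u)\<^sup>2 \<Prod>\<^bsub>P | Q\<^esub> (1 + u\<^bsup>deg P\<^esup>) = (1 - q u\<^sup>2) L(u, \<chi>) L(u, \<chi>')\<close>.
  Hence inside the unit disc \<open>F\<close> has only a double pole, at \<open>u = 1/q\<close>, whose principal part gives
  the two main terms. If \<open>L(1, \<chi>) = 0\<close>, the logarithmic derivative is the junk value \<open>0\<close>, but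
  the corresponding term of the principal part also vanishes.\<close>

subsection \<open>Characters of finite abelian groups\<close>

text \<open>Why the factor over \<open>P | Q\<close> appears: a common gcd \<open>g\<close> carries
  the weight \<open>|chi(g)|^2\<close>, which is the principal character, and it is counted by
  \<open>u^(deg g)\<close> in \<open>F\<close> but by \<open>u^(2 deg g)\<close> in the product of
  the two L-series. The comparison of the zeta series without the primes of \<open>Q\<close>, once
  in \<open>u\<close> and once in \<open>u^2\<close>, leaves the quotient of
  \<open>1 - u^(2 deg P)\<close> by \<open>1 - u^(deg P)\<close>. The L-series are polynomials, so
  only the zeros of these factors limit the disc of convergence. They lie on \<open>|u| = 1\<close>,
  which is why the estimate is made on the circle \<open>|u| = q^(-\<epsilon>)\<close>. The
  coefficients of \<open>F\<close> are finite convolutions with \<open>(n+1) q^n\<close>; the main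
  terms are the same convolutions continued to infinity, and the tail is at most a multiple of
  \<open>x / (1-x)^2\<close> with \<open>x = q^(\<epsilon>-1)\<close>. This is
  \<open>q^(1-\<epsilon>) / (q^(1-\<epsilon>) - 1)^2\<close>, the origin of the last factor of the
  error term. Orthogonality in the residue variable needs enough characters. They are built by
  extending a character from one subgroup to the next.\<close>

definition multiplicative_on :: "('b, 'm) monoid_scheme \<Rightarrow> 'b set \<Rightarrow> ('b \<Rightarrow> complex) \<Rightarrow> bool" where
  "multiplicative_on G H \<psi> \<longleftrightarrow>
     (\<forall>x\<in>H. \<psi> x \<noteq> 0) \<and> (\<forall>x\<in>H. \<forall>y\<in>H. \<psi> (x \<otimes>\<^bsub>G\<^esub> y) = \<psi> x * \<psi> y)"

lemma (in group) multiplicative_on_pow: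
  assumes "subgroup H G" "multiplicative_on G H \<psi>" "x \<in> H"
  shows "x [^] (n::nat) \<in> H \<and> \<psi> (x [^] n) = \<psi> x ^ n"
proof (induction n)
  case 0
  have "\<one> \<in> H" using assms(1) by (rule subgroup.one_closed)
  then have "\<psi> (\<one> \<otimes> \<one>) = \<psi> \<one> * \<psi> \<one>" "\<psi> \<one> \<noteq> 0"
    using assms(2) unfolding multiplicative_on_def by blast+
  then show ?case using \<open>\<one> \<in> H\<close> by simp
next
  case (Suc n)
  then show ?case using assms
    by (simp add: multiplicative_on_def subgroup.m_closed mult.commute)
qed

lemma (in group) subgroup_left_cancel:
  assumes "subgroup H G" "x \<in> H" "y \<in> carrier G" "x \<otimes> y \<in> H"
  shows "y \<in> H"
proof -
  have "inv x \<otimes> (x \<otimes> y) \<in> H"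
    using assms by (meson subgroup.m_closed subgroup.m_inv_closed)
  then show ?thesis
    using assms subgroup.mem_carrier[OF assms(1,2)] by (simp flip: m_assoc)
qed

text \<open>The products \<open>h a^j\<close> form the subgroup generated by \<open>H\<close> and
  \<open>a\<close>, and \<open>h a^j\<close> is sent to \<open>\<psi> h * c^j\<close>. Two
  representations of one element differ by a power of \<open>a\<close> lying in \<open>H\<close>,
  whose exponent is a multiple of \<open>k\<close>; there the condition on \<open>c ^ k\<close>
  makes both values agree.\<close>

lemma (in comm_group) extend_character_step:
  assumes H: "subgroup H G" and \<psi>: "multiplicative_on G H \<psi>" and fin: "finite (carrier G)"
    and a: "a \<in> carrier G" and k: "k > 0" "a [^] (k::nat) \<in> H"
    and min: "\<And>j. 0 < j \<Longrightarrow> j < k \<Longrightarrow> a [^] j \<notin> H" and c: "c ^ k = \<psi> (a [^] k)"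
  shows "\<exists>H' \<psi>'. subgroup H' G \<and> multiplicative_on G H' \<psi>' \<and> H \<subseteq> H' \<and> a \<in> H' \<and>
           (\<forall>x\<in>H. \<psi>' x = \<psi> x) \<and> \<psi>' a = c"
proof -
  interpret H: subgroup H G by fact
  define e where "e = (\<lambda>(h, j::nat). h \<otimes> a [^] j)"
  define H' where "H' = e ` (H \<times> UNIV)"
  define val where "val = (\<lambda>(h, j::nat). \<psi> h * c ^ j)"
  define \<psi>' where "\<psi>' x = val (SOME p. p \<in> H \<times> UNIV \<and> e p = x)" for x
  have c0: "c \<noteq> 0"
    using c k \<psi> unfolding multiplicative_on_def by (metis power_0_left less_numeral_extra(3))
  \<comment> \<open>Division with remainder: otherwise \<open>a [^] (j mod k)\<close> would lie in
    \<open>H\<close>, against the minimality of \<open>k\<close>.\<close>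
  have dvd: "k dvd j" if "a [^] j \<in> H" for j
  proof (rule ccontr)
    assume "\<not> k dvd j"
    then have r: "0 < j mod k" "j mod k < k" using k by (auto simp: dvd_eq_mod_eq_0)
    have "a [^] j = a [^] (k * (j div k)) \<otimes> a [^] (j mod k)"
      using a by (simp add: nat_pow_mult)
    then have "a [^] j = (a [^] k) [^] (j div k) \<otimes> a [^] (j mod k)"
      using a by (simp add: nat_pow_pow)
    moreover have "(a [^] k) [^] (j div k) \<in> H"
      using multiplicative_on_pow[OF H \<psi> k(2)] by simp
    ultimately have "a [^] (j mod k) \<in> H"
      using that subgroup_left_cancel[OF H] a by (metis nat_pow_closed)
    with min r show False by blast
  qed
  have well': "\<psi> h * c ^ i = \<psi> h' * c ^ j"
    if "h \<in> H" "h' \<in> H" "h \<otimes> a [^] i = h' \<otimes> a [^] j" "i \<le> j" for h h' i j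
  proof -
    have "a [^] j = a [^] (j - i) \<otimes> a [^] i" using a that by (simp add: nat_pow_mult)
    then have "h \<otimes> a [^] i = (h' \<otimes> a [^] (j - i)) \<otimes> a [^] i"
      using that a by (simp add: m_assoc)
    then have h: "h = h' \<otimes> a [^] (j - i)" using that a by (simp add: right_cancel)
    then have aH: "a [^] (j - i) \<in> H"
      using that subgroup_left_cancel[OF H] a by (metis nat_pow_closed)
    then obtain t where t: "j - i = k * t" using dvd by blast
    have "\<psi> (a [^] (j - i)) = \<psi> ((a [^] k) [^] t)" using a t by (simp add: nat_pow_pow)
    also have "\<dots> = c ^ (j - i)"
      using multiplicative_on_pow[OF H \<psi> k(2)] c t by (simp add: power_mult)
    finally have "\<psi> h = \<psi> h' * c ^ (j - i)"
      using h that aH \<psi> by (simp add: multiplicative_on_def)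
    then show ?thesis using that by (simp add: mult.assoc flip: power_add)
  qed
  have well: "val p = val p'" if "p \<in> H \<times> UNIV" "p' \<in> H \<times> UNIV" "e p = e p'" for p p'
    using that well'[of "fst p" "fst p'" "snd p" "snd p'"] well'[of "fst p'" "fst p" "snd p'" "snd p"]
    by (cases "snd p \<le> snd p'") (auto simp: e_def val_def split: prod.splits)
  have \<psi>'_e: "\<psi>' (e p) = val p" if "p \<in> H \<times> UNIV" for p
  proof -
    define p' where "p' = (SOME p'. p' \<in> H \<times> UNIV \<and> e p' = e p)"
    have "p' \<in> H \<times> UNIV \<and> e p' = e p"
      unfolding p'_def by (rule someI[of _ p]) (use that in simp)
    then show ?thesis
      using well[of p' p] that by (simp add: \<psi>'_def p'_def)
  qed
  have e_mult: "e (h, i) \<otimes> e (h', j) = e (h \<otimes> h', i + j)" if "h \<in> H" "h' \<in> H" for h h' i j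
    using that a nat_pow_mult[OF a, of i j] by (simp add: e_def m_ac)
  have "subgroup H' G"
  proof (rule subgroupI)
    show "H' \<subseteq> carrier G" using a by (auto simp: H'_def e_def)
    show "H' \<noteq> {}" using H.one_closed unfolding H'_def by blast
    show "inv x \<in> H'" if x: "x \<in> H'" for x
    proof -
      obtain h j where hj: "h \<in> H" "x = h \<otimes> a [^] (j::nat)"
        using x by (auto simp: H'_def e_def)
      \<comment> \<open>Exponents are natural numbers, so the inverse of \<open>a [^] j\<close> has
        to be a nonnegative power; Lagrange's theorem provides one.\<close>
      have "j + j * (order G - 1) = order G * j"
        using fin order_gt_0_iff_finite by (cases "order G") (auto simp: algebra_simps)
      then have "a [^] j \<otimes> a [^] (j * (order G - 1)) = a [^] (order G * j)"
        using a by (simp add: nat_pow_mult)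
      also have "\<dots> = (a [^] order G) [^] j" using a by (simp add: nat_pow_pow)
      also have "\<dots> = \<one>" using power_order_eq_one[OF fin a] by (simp add: order_def)
      finally have "inv (a [^] j) = a [^] (j * (order G - 1))"
        using a by (metis inv_equality m_comm nat_pow_closed)
      then have "inv x = e (inv h, j * (order G - 1))"
        using hj a by (simp add: inv_mult e_def)
      then show ?thesis using hj by (auto simp: H'_def)
    qed
    show "x \<otimes> y \<in> H'" if "x \<in> H'" "y \<in> H'" for x y
      using that e_mult by (auto simp: H'_def)
  qed
  moreover have "multiplicative_on G H' \<psi>'"
    unfolding multiplicative_on_def
  proof (intro conjI ballI)
    fix x assume "x \<in> H'"
    then show "\<psi>' x \<noteq> 0"
      using \<psi>'_e c0 \<psi> by (auto simp: H'_def val_def multiplicative_on_def)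
  next
    fix x y assume "x \<in> H'" "y \<in> H'"
    then obtain h i h' j where *: "h \<in> H" "h' \<in> H" "x = e (h, i)" "y = e (h', j)"
      by (auto simp: H'_def)
    then have "\<psi>' (x \<otimes> y) = val (h \<otimes> h', i + j)"
      using e_mult \<psi>'_e by simp
    also have "\<dots> = \<psi>' x * \<psi>' y"
      using * \<psi>'_e \<psi> by (simp add: val_def multiplicative_on_def power_add)
    finally show "\<psi>' (x \<otimes> y) = \<psi>' x * \<psi>' y" .
  qed
  moreover have eH: "x = e (x, 0)" if "x \<in> H" for x
    using that by (simp add: e_def)
  moreover have ea: "a = e (\<one>, 1)" using a by (simp add: e_def)
  moreover have "\<psi>' x = \<psi> x" if "x \<in> H" for x
    using \<psi>'_e[of "(x, 0)"] eH that by (simp add: val_def)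
  moreover have "\<psi>' a = c"
    using \<psi>'_e[of "(\<one>, 1)"] ea multiplicative_on_pow[OF H \<psi> H.one_closed, of 0]
    by (simp add: val_def)
  moreover have "H \<subseteq> H'" "a \<in> H'"
    using eH ea by (auto simp: H'_def intro!: image_eqI[of a e "(\<one>, 1)"] image_eqI[of _ e "(_, 0)"])
  ultimately show ?thesis by blast
qed

text \<open>Here \<open>k\<close> is the order of \<open>a\<close> in the quotient by
  \<open>H\<close>. Some exponent exists because \<open>a [^] order G\<close> is the
  identity.\<close>

lemma (in comm_group) least_pow_mem_subgroup:
  assumes "subgroup H G" "finite (carrier G)" "a \<in> carrier G"
  obtains k :: nat where "k > 0" "a [^] k \<in> H" "\<And>j. 0 < j \<Longrightarrow> j < k \<Longrightarrow> a [^] j \<notin> H"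
proof -
  have "order G > 0" using assms order_gt_0_iff_finite by blast
  moreover have "a [^] order G \<in> H"
    using power_order_eq_one[OF assms(2,3)] subgroup.one_closed[OF assms(1)] by (simp add: order_def)
  ultimately have "\<exists>k. k > 0 \<and> a [^] (k::nat) \<in> H" by blast
  from exists_least_iff[THEN iffD1, OF this] show ?thesis using that by blast
qed

text \<open>A subgroup of largest cardinality among those that contain \<open>a\<close> and carry a
  character nontrivial at \<open>a\<close> is the whole group: otherwise a missing element
  \<open>b\<close> could be adjoined, because nonzero complex numbers have \<open>k\<close>-th
  roots.\<close>

lemma (in comm_group) character_separates:
  assumes fin: "finite (carrier G)" and a: "a \<in> carrier G" "a \<noteq> \<one>"
  shows "\<exists>\<psi>. multiplicative_on G (carrier G) \<psi> \<and> \<psi> a \<noteq> 1"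
proof -
  define S where "S = {H. subgroup H G \<and> a \<in> H \<and> (\<exists>\<psi>. multiplicative_on G H \<psi> \<and> \<psi> a \<noteq> 1)}"
  have "S \<noteq> {}"
  proof -
    have triv: "subgroup {\<one>} G" by (rule triv_subgroup)
    obtain k :: nat where k: "k > 0" "a [^] k \<in> {\<one>}"
        "\<And>j. 0 < j \<Longrightarrow> j < k \<Longrightarrow> a [^] j \<notin> {\<one>}"
      using least_pow_mem_subgroup[OF triv fin a(1)] by metis
    have "k \<noteq> 1" using k(2) a by auto
    \<comment> \<open>A primitive \<open>k\<close>-th root of unity, with \<open>k\<close> the order
      of \<open>a\<close>. Its \<open>k\<close>-th power is the value of the trivial character, and
      it is not \<open>1\<close> since \<open>k\<close> exceeds \<open>1\<close>.\<close>
    define c where "c = cis (2 * pi / real k)"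
    have "c ^ k = 1" using k(1) by (simp add: c_def Complex.DeMoivre)
    have "c \<noteq> 1"
    proof
      assume "c = 1"
      have "inj_on (\<lambda>i. cis (2 * pi * real i / real k)) {..<k}"
        using Complex.bij_betw_roots_unity[OF k(1)] by (rule bij_betw_imp_inj_on)
      moreover have "cis (2 * pi * real 1 / real k) = cis (2 * pi * real 0 / real k)"
        using \<open>c = 1\<close> by (simp add: c_def)
      ultimately show False using k(1) \<open>k \<noteq> 1\<close>
        by (metis (mono_tags, lifting) inj_onD lessThan_iff less_one nat_neq_iff zero_neq_one)
    qed
    have "multiplicative_on G {\<one>} (\<lambda>_. 1)" by (simp add: multiplicative_on_def)
    from extend_character_step[OF triv this fin a(1) k, of c] \<open>c ^ k = 1\<close>
    show ?thesis using \<open>c \<noteq> 1\<close> unfolding S_def by auto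
  qed
  moreover have "finite S"
    by (rule finite_subset[of _ "Pow (carrier G)"]) (use fin in \<open>auto simp: S_def dest: subgroup.subset\<close>)
  ultimately obtain H where H: "H \<in> S" "\<And>H'. H' \<in> S \<Longrightarrow> card H' \<le> card H"
    by (metis Max_ge obtains_MAX finite_imageI imageI)
  then obtain \<psi> where \<psi>: "subgroup H G" "a \<in> H" "multiplicative_on G H \<psi>" "\<psi> a \<noteq> 1"
    unfolding S_def by blast
  have "H = carrier G"
  proof (rule ccontr)
    assume "H \<noteq> carrier G"
    then obtain b where b: "b \<in> carrier G" "b \<notin> H"
      using subgroup.subset[OF \<psi>(1)] by blast
    obtain k :: nat where k: "k > 0" "b [^] k \<in> H" "\<And>j. 0 < j \<Longrightarrow> j < k \<Longrightarrow> b [^] j \<notin> H"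
      using least_pow_mem_subgroup[OF \<psi>(1) fin b(1)] by metis
    define c where "c = exp (Ln (\<psi> (b [^] k)) / of_nat k)"
    have "\<psi> (b [^] k) \<noteq> 0" using \<psi>(3) k(2) by (auto simp: multiplicative_on_def)
    then have "c ^ k = \<psi> (b [^] k)"
      using k(1) by (simp add: c_def flip: exp_of_nat_mult)
    from extend_character_step[OF \<psi>(1,3) fin b(1) k this]
    obtain H' \<psi>' where H': "subgroup H' G" "multiplicative_on G H' \<psi>'" "H \<subseteq> H'" "b \<in> H'"
        "\<forall>x\<in>H. \<psi>' x = \<psi> x" by metis
    have "H' \<in> S" using H' \<psi> unfolding S_def by auto
    moreover have "card H < card H'"
      using H' b fin by (intro psubset_card_mono) (auto intro: finite_subset dest: subgroup.subset)
    ultimately show False using H(2) by fastforce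
  qed
  then show ?thesis using \<psi> by blast
qed

subsection \<open>Dirichlet characters modulo a polynomial\<close>

lemma poly_bezout:
  fixes a b :: "'a::field poly"
  shows "\<exists>g x y. g dvd a \<and> g dvd b \<and> g = x * a + y * b"
proof (induction "euclidean_size b" arbitrary: a b rule: less_induct)
  case less
  show ?case
  proof (cases "b = 0")
    case True
    then have "a dvd a \<and> a dvd b \<and> a = 1 * a + 0 * b" by simp
    then show ?thesis by blast
  next
    case False
    then have "euclidean_size (a mod b) < euclidean_size b" by (rule mod_size_less)
    from less[OF this, of b] obtain g x y
      where g: "g dvd b" "g dvd a mod b" "g = x * b + y * (a mod b)" by blast
    have "g = y * a + (x - y * (a div b)) * b"
      using g(3) by (simp add: algebra_simps flip: minus_div_mult_eq_mod)
    moreover have "g dvd a" using g(1,2) dvd_mod_iff by blast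
    ultimately show ?thesis using g(1) by blast
  qed
qed

lemma coprime_poly_iff_bezout:
  fixes a b :: "'a::field poly"
  shows "coprime a b \<longleftrightarrow> (\<exists>x y. x * a + y * b = 1)"
proof
  assume "coprime a b"
  obtain g x y where g: "g dvd a" "g dvd b" "g = x * a + y * b" using poly_bezout by blast
  then have "g dvd 1" using \<open>coprime a b\<close> coprime_common_divisor by blast
  then obtain k where "1 = g * k" by blast
  then have "(k * x) * a + (k * y) * b = 1" using g(3) by (simp add: algebra_simps)
  then show "\<exists>x y. x * a + y * b = 1" by blast
next
  assume "\<exists>x y. x * a + y * b = 1"
  then obtain x y where "x * a + y * b = 1" by blast
  then show "coprime a b"
    by (intro coprimeI) (metis dvd_add dvd_mult)
qed

lemma coprime_mult_poly_iff:
  fixes f g :: "'a::field poly"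
  shows "coprime (f * g) Q \<longleftrightarrow> coprime f Q \<and> coprime g Q"
proof
  assume "coprime (f * g) Q"
  then obtain x y where *: "x * (f * g) + y * Q = 1" using coprime_poly_iff_bezout by blast
  then have "(x * g) * f + y * Q = 1" "(x * f) * g + y * Q = 1" by (simp_all add: algebra_simps)
  then show "coprime f Q \<and> coprime g Q" using coprime_poly_iff_bezout by blast
next
  assume "coprime f Q \<and> coprime g Q"
  then obtain x y x' y' where *: "x * f + y * Q = 1" "x' * g + y' * Q = 1"
    using coprime_poly_iff_bezout by metis
  have "(x * x') * (f * g) + (x * f * y' + y * (x' * g) + y * y' * Q) * Q
        = (x * f + y * Q) * (x' * g + y' * Q)" by (simp add: algebra_simps)
  then show "coprime (f * g) Q" using * coprime_poly_iff_bezout by (metis mult_1)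
qed

lemma coprime_dvd_mult_poly:
  fixes a b c :: "'a::field poly"
  assumes "coprime a b" "a dvd b * c"
  shows "a dvd c"
proof -
  obtain x y where "x * a + y * b = 1" using assms(1) coprime_poly_iff_bezout by blast
  then have "c = (x * a + y * b) * c" by simp
  also have "\<dots> = a * (x * c) + y * (b * c)" by (simp add: algebra_simps)
  finally show ?thesis using assms(2) by (metis dvd_add dvd_mult dvd_triv_left)
qed

lemma coprime_poly_cong:
  fixes f g Q :: "'a::{finite,field} poly"
  assumes "[f = g] (mod Q)"
  shows "coprime f Q \<longleftrightarrow> coprime g Q"
proof -
  have "d dvd f \<longleftrightarrow> d dvd g" if "d dvd Q" for d
    using that assms by (meson cong_dvd_iff cong_dvd_modulus)
  then show ?thesis unfolding coprime_def by blast
qed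

lemma finite_degree_le: "finite {p :: 'a::{finite,zero} poly. degree p \<le> n}"
proof (induction n)
  case 0
  have "{p :: 'a poly. degree p \<le> 0} \<subseteq> range (\<lambda>c. [:c:])"
    by (auto elim: degree_eq_zeroE)
  then show ?case by (rule finite_subset) simp
next
  case (Suc n)
  have "{p :: 'a poly. degree p \<le> Suc n} \<subseteq> (\<lambda>(c, p). pCons c p) ` (UNIV \<times> {p. degree p \<le> n})"
  proof
    fix p :: "'a poly" assume p: "p \<in> {p. degree p \<le> Suc n}"
    obtain c r where r: "p = pCons c r" by (cases p)
    then have "degree r \<le> n" using p by (cases "r = 0") auto
    then show "p \<in> (\<lambda>(c, p). pCons c p) ` (UNIV \<times> {p. degree p \<le> n})" using r by auto
  qed
  then show ?case by (rule finite_subset) (use Suc in simp)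
qed

lemma finite_degree_eq [simp]: "finite {p :: 'a::{finite,zero} poly. P p \<and> degree p = n}"
  by (rule finite_subset[OF _ finite_degree_le[of n]]) auto

lemma monic_nonzero: "is_monic f \<Longrightarrow> f \<noteq> 0"
  by auto

lemma finite_monic_divisors:
  fixes f :: "'a::{finite,field} poly"
  assumes "f \<noteq> 0"
  shows "finite {d. is_monic d \<and> d dvd f}"
  by (rule finite_subset[OF _ finite_degree_le[of "degree f"]]) (use assms in \<open>auto intro: dvd_imp_degree_le\<close>)

text \<open>The quantity \<open>r(f)\<close> of the overview.\<close>

definition divisor_sum :: "('a::{finite,field} poly \<Rightarrow> complex) \<Rightarrow> 'a poly \<Rightarrow> complex" where
  "divisor_sum chi f = (\<Sum>d | is_monic d \<and> d dvd f. chi d)"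

section \<open>The unit group modulo \<open>Q\<close>, its characters and their
  orthogonality\<close>

locale poly_modulus =
  fixes Q :: "'a::{finite,field} poly"
  assumes Q_nonzero: "Q \<noteq> 0"
begin

abbreviation "R \<equiv> reduced_residues Q"
abbreviation "characters \<equiv> {chi. dirichlet_character Q chi}"

lemma finite_residues: "finite {h. h mod Q = h}"
proof (rule finite_subset[OF _ finite_degree_le[of "degree Q"]])
  show "{h. h mod Q = h} \<subseteq> {h. degree h \<le> degree Q}"
    using degree_mod_less[OF Q_nonzero] by (auto, metis degree_0 le0 less_imp_le)
qed

lemma finite_reduced_residues [simp]: "finite R"
  by (rule finite_subset[OF _ finite_residues]) (auto simp: reduced_residues_def)

lemma coprime_mod [simp]: "coprime (f mod Q) Q \<longleftrightarrow> coprime f Q"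
  by (rule coprime_poly_cong) simp

lemma mod_in_reduced [simp]: "f mod Q \<in> R \<longleftrightarrow> coprime f Q"
  by (simp add: reduced_residues_def)

lemma reducedD: "h \<in> R \<Longrightarrow> coprime h Q" "h \<in> R \<Longrightarrow> h mod Q = h"
  by (simp_all add: reduced_residues_def)

lemma reduced_inverse:
  assumes "coprime f Q"
  obtains g where "coprime g Q" "[f * g = 1] (mod Q)"
proof -
  obtain x y where xy: "x * f + y * Q = 1" using assms coprime_poly_iff_bezout by blast
  then have "y * Q + f * x = 1" by (simp add: algebra_simps)
  then have 1: "[f * x = 1] (mod Q)" unfolding cong_def by (metis mod_mult_self3)
  have "f * x + y * Q = 1" using xy by (simp add: algebra_simps)
  then have "1 * (f * x) + y * Q = 1" by simp
  then have "coprime (f * x) Q" unfolding coprime_poly_iff_bezout by blast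
  then show ?thesis using 1 that coprime_mult_poly_iff by blast
qed

text \<open>Reconciles two descriptions in the statement: \<open>Phi\<close> counts units, while the
  variance sums over residues coprime to \<open>Q\<close>.\<close>

lemma residue_units_eq: "residue_units Q = R"
proof -
  have "coprime h Q \<longleftrightarrow> (\<exists>g. [h * g = 1] (mod Q))" for h
  proof
    assume "\<exists>g. [h * g = 1] (mod Q)"
    then obtain g where "[h * g = 1] (mod Q)" by blast
    then have "coprime (h * g) Q" using coprime_poly_cong by (metis coprime_1_left)
    then show "coprime h Q" by (simp add: coprime_mult_poly_iff)
  qed (metis reduced_inverse)
  then show ?thesis by (auto simp: residue_units_def reduced_residues_def)
qed

lemma Phi_eq: "Phi Q = card R"
  by (simp add: Phi_def residue_units_eq)

lemma one_mod_in_reduced: "1 mod Q \<in> R"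
  by simp

lemma Phi_pos: "Phi Q > 0"
  unfolding Phi_eq card_gt_0_iff using one_mod_in_reduced finite_reduced_residues by blast

lemma bij_mult_reduced:
  assumes "coprime f Q"
  shows "bij_betw (\<lambda>h. f * h mod Q) R R"
proof -
  obtain g where g: "coprime g Q" "[f * g = 1] (mod Q)" using reduced_inverse assms by blast
  have *: "a * (b * h mod Q) mod Q = h" if "[b * a = 1] (mod Q)" "h \<in> R" for a b h
  proof -
    have "[a * (b * h mod Q) = (b * a) * h] (mod Q)"
      by (simp add: cong_def mod_mult_right_eq ac_simps)
    also have "[(b * a) * h = 1 * h] (mod Q)" by (intro cong_scalar_right that)
    finally show ?thesis using reducedD(2)[OF that(2)] by (simp add: cong_def)
  qed
  show ?thesis
    by (rule bij_betw_byWitness[where f' = "\<lambda>h. g * h mod Q"])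
       (use g assms *[of f g] *[of g f] in
         \<open>simp_all add: coprime_mult_poly_iff mult.commute[of g f] reducedD(1) image_subset_iff\<close>)
qed

text \<open>The identity is \<open>1 mod Q\<close> and not \<open>1\<close>: for constant
  \<open>Q\<close> the only remainder is \<open>0\<close>, and the group is trivial.\<close>

lemma comm_group_residues:
  "comm_group \<lparr>carrier = R, monoid.mult = (\<lambda>x y. x * y mod Q), one = 1 mod Q\<rparr>" (is "comm_group ?G")
proof (rule comm_groupI)
  fix x assume "x \<in> carrier ?G"
  then have x: "x \<in> R" by simp
  then obtain g where g: "coprime g Q" "[x * g = 1] (mod Q)" using reduced_inverse reducedD by blast
  have "(g mod Q) * x mod Q = 1 mod Q"
    using g(2) by (simp add: cong_def mod_mult_left_eq mult.commute[of x])
  then show "\<exists>y\<in>carrier ?G. y \<otimes>\<^bsub>?G\<^esub> x = \<one>\<^bsub>?G\<^esub>"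
    using g(1) by (intro bexI[of _ "g mod Q"]) simp_all
qed (auto simp: coprime_mult_poly_iff mod_mult_left_eq mod_mult_right_eq mult_ac reducedD)

lemma character_cong: "dirichlet_character Q chi \<Longrightarrow> [f = g] (mod Q) \<Longrightarrow> chi f = chi g"
  unfolding dirichlet_character_def by blast

lemma character_mod: "dirichlet_character Q chi \<Longrightarrow> chi (f mod Q) = chi f"
  by (rule character_cong) simp_all

text \<open>The definition demands this only for arguments coprime to \<open>Q\<close>; in all other
  cases both sides vanish.\<close>

lemma character_mult:
  "dirichlet_character Q chi \<Longrightarrow> chi (f * g) = chi f * chi g"
  unfolding dirichlet_character_def by (metis coprime_mult_poly_iff mult_eq_0_iff)

lemma character_eq_0_iff: "dirichlet_character Q chi \<Longrightarrow> chi f = 0 \<longleftrightarrow> \<not> coprime f Q"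
  unfolding dirichlet_character_def by blast

lemma character_1: "dirichlet_character Q chi \<Longrightarrow> chi 1 = 1"
  using character_mult[of chi 1 1] character_eq_0_iff[of chi 1] by simp

text \<open>Euler's argument: multiplication by \<open>f\<close> permutes \<open>R\<close>, and the
  nonzero product of all \<open>chi h\<close> cancels.\<close>

lemma character_pow_Phi:
  assumes "dirichlet_character Q chi" "coprime f Q"
  shows "chi f ^ Phi Q = 1"
proof -
  have "(\<Prod>h\<in>R. chi h) = (\<Prod>h\<in>R. chi (f * h mod Q))"
    by (rule prod.reindex_bij_betw[symmetric, OF bij_mult_reduced[OF assms(2)]])
  also have "\<dots> = chi f ^ Phi Q * (\<Prod>h\<in>R. chi h)"
    using assms by (simp add: character_mod character_mult prod.distrib Phi_eq)
  finally show ?thesis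
    using character_eq_0_iff[OF assms(1)] reducedD(1) by (auto simp: prod_zero_iff)
qed

lemma character_norm:
  assumes "dirichlet_character Q chi" "coprime f Q"
  shows "cmod (chi f) = 1"
  using character_pow_Phi[OF assms] Phi_pos
  by (metis norm_one norm_power norm_ge_zero power_eq_1_iff not_gr_zero)

lemma character_norm_sq:
  "dirichlet_character Q chi \<Longrightarrow> chi f * cnj (chi f) = principal_character Q f"
  using character_norm[of chi f] character_eq_0_iff[of chi f]
  by (auto simp: principal_character_def complex_norm_square[symmetric])

lemma principal_in_characters: "dirichlet_character Q (principal_character Q)"
  by (auto simp: dirichlet_character_def principal_character_def coprime_mult_poly_iff
      dest: coprime_poly_cong)

text \<open>A character is determined by its values on \<open>R\<close>, and these are roots of
  unity of order dividing \<open>Phi Q\<close>.\<close>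

lemma finite_characters: "finite characters"
proof -
  define F where "F = (R \<rightarrow>\<^sub>E {z :: complex. z ^ Phi Q = 1})"
  have "finite F"
    unfolding F_def using Phi_pos by (intro finite_PiE finite_roots_unity) auto
  moreover have "(\<lambda>chi. restrict chi R) ` characters \<subseteq> F"
    by (auto simp: F_def character_pow_Phi reducedD)
  moreover have "inj_on (\<lambda>chi. restrict chi R) characters"
  proof (rule inj_onI)
    fix chi chi' assume *: "chi \<in> characters" "chi' \<in> characters" "restrict chi R = restrict chi' R"
    show "chi = chi'"
    proof
      fix f
      show "chi f = chi' f"
      proof (cases "coprime f Q")
        case True
        then have "chi (f mod Q) = chi' (f mod Q)"
          using fun_cong[OF *(3), of "f mod Q"] by simp
        then show ?thesis using * by (simp add: character_mod)
      qed (use * character_eq_0_iff[of chi f] character_eq_0_iff[of chi' f] in auto)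
    qed
  qed
  ultimately show ?thesis by (meson finite_imageD finite_subset)
qed

lemma character_separation:
  assumes "coprime a Q" "\<not> [a = 1] (mod Q)"
  shows "\<exists>chi. dirichlet_character Q chi \<and> chi a \<noteq> 1"
proof -
  define G where "G = \<lparr>carrier = R, monoid.mult = (\<lambda>x y. x * y mod Q), one = 1 mod Q\<rparr>"
  interpret comm_group G unfolding G_def by (rule comm_group_residues)
  have "finite (carrier G)" "a mod Q \<in> carrier G" "a mod Q \<noteq> one G"
    using assms by (simp_all add: G_def cong_def)
  then obtain psi where psi: "multiplicative_on G (carrier G) psi" "psi (a mod Q) \<noteq> 1"
    using character_separates by blast
  define chi where "chi f = (if coprime f Q then psi (f mod Q) else 0)" for f
  have "dirichlet_character Q chi"
    unfolding dirichlet_character_def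
  proof (intro conjI allI impI)
    fix f g assume "coprime f Q" "coprime g Q"
    then have "psi (f mod Q * (g mod Q) mod Q) = psi (f mod Q) * psi (g mod Q)"
      using psi(1) by (simp add: multiplicative_on_def G_def)
    then show "chi (f * g) = chi f * chi g"
      using \<open>coprime f Q\<close> \<open>coprime g Q\<close>
      by (simp add: chi_def coprime_mult_poly_iff mod_mult_eq)
  next
    fix f assume "coprime f Q"
    then show "chi f \<noteq> 0" using psi(1) by (simp add: chi_def multiplicative_on_def G_def)
  qed (auto simp: chi_def cong_def dest: coprime_poly_cong[unfolded cong_def])
  then show ?thesis using psi(2) assms(1) chi_def by auto
qed

lemma sum_character_reduced:
  assumes "dirichlet_character Q chi"
  shows "(\<Sum>h\<in>R. chi h) = (if chi = principal_character Q then of_nat (Phi Q) else 0)"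
proof (cases "chi = principal_character Q")
  case True
  then show ?thesis by (simp add: principal_character_def Phi_eq reducedD)
next
  case False
  then obtain f where f: "chi f \<noteq> principal_character Q f" by blast
  then have cop: "coprime f Q" and ne: "chi f \<noteq> 1"
    using assms character_eq_0_iff[of chi f] by (auto simp: principal_character_def split: if_splits)
  have "(\<Sum>h\<in>R. chi h) = (\<Sum>h\<in>R. chi (f * h mod Q))"
    by (rule sum.reindex_bij_betw[symmetric, OF bij_mult_reduced[OF cop]])
  also have "\<dots> = chi f * (\<Sum>h\<in>R. chi h)"
    using assms by (simp add: character_mod character_mult sum_distrib_left)
  finally show ?thesis using False ne by simp
qed

text \<open>Multiplication by a character \<open>psi\<close> with \<open>psi a \<noteq> 1\<close>
  permutes the characters, its inverse being multiplication by the conjugate of \<open>psi\<close>;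
  so the sum is fixed under multiplication by \<open>psi a\<close>.\<close>

lemma sum_characters_eq_0:
  assumes "coprime a Q" "\<not> [a = 1] (mod Q)"
  shows "(\<Sum>chi\<in>characters. chi a) = 0"
proof -
  obtain psi where psi: "dirichlet_character Q psi" "psi a \<noteq> 1"
    using character_separation[OF assms] by blast
  have prod: "dirichlet_character Q (\<lambda>f. chi f * chi' f)"
    if "dirichlet_character Q chi" "dirichlet_character Q chi'" for chi chi'
    using that character_mult[OF that(1)] character_mult[OF that(2)]
      character_eq_0_iff[OF that(1)] character_eq_0_iff[OF that(2)]
      character_cong[OF that(1)] character_cong[OF that(2)]
    by (auto simp: dirichlet_character_def)
  have conj: "dirichlet_character Q (\<lambda>f. cnj (chi f))" if "dirichlet_character Q chi" for chi
    using that character_cong[OF that] character_mult[OF that] character_eq_0_iff[OF that]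
    by (auto simp: dirichlet_character_def)
  have inv: "(\<lambda>f. psi f * (cnj (psi f) * chi f)) = chi"
    "(\<lambda>f. cnj (psi f) * (psi f * chi f)) = chi" if "dirichlet_character Q chi" for chi
  proof -
    have "psi f * cnj (psi f) * chi f = chi f" for f
      using character_norm_sq[OF psi(1), of f] character_eq_0_iff[OF that, of f]
      by (simp add: principal_character_def)
    then show "(\<lambda>f. psi f * (cnj (psi f) * chi f)) = chi"
      "(\<lambda>f. cnj (psi f) * (psi f * chi f)) = chi" by (auto simp: mult_ac)
  qed
  have "bij_betw (\<lambda>chi f. psi f * chi f) characters characters"
    by (rule bij_betw_byWitness[where f' = "\<lambda>chi f. cnj (psi f) * chi f"])
       (auto simp: inv intro!: prod conj psi(1))
  from sum.reindex_bij_betw[OF this, of "\<lambda>chi. chi a"]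
  have "psi a * (\<Sum>chi\<in>characters. chi a) = (\<Sum>chi\<in>characters. chi a)"
    by (simp add: sum_distrib_left)
  then show ?thesis using psi(2) by simp
qed

text \<open>The sum of \<open>chi h\<close> over all \<open>chi\<close> and \<open>h\<close> is
  evaluated in both orders: only the principal character survives in one, only the residue of
  \<open>1\<close> in the other.\<close>

lemma card_characters: "card characters = Phi Q"
proof -
  have "of_nat (Phi Q) = (\<Sum>chi\<in>characters. \<Sum>h\<in>R. chi h)"
    using finite_characters principal_in_characters by (simp add: sum_character_reduced sum.delta)
  also have "\<dots> = (\<Sum>h\<in>R. \<Sum>chi\<in>characters. chi h)" by (rule sum.swap)
  also have "\<dots> = (\<Sum>h\<in>R. if h = 1 mod Q then of_nat (card characters) else 0)"
  proof (rule sum.cong[OF refl])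
    fix h assume h: "h \<in> R"
    show "(\<Sum>chi\<in>characters. chi h) = (if h = 1 mod Q then of_nat (card characters) else 0)"
    proof (cases "h = 1 mod Q")
      case True
      then have "(\<Sum>chi\<in>characters. chi h) = (\<Sum>chi\<in>characters. 1)"
        by (intro sum.cong) (auto simp: character_mod character_1)
      then show ?thesis using True by simp
    next
      case False
      then show ?thesis using sum_characters_eq_0[of h] h by (auto simp: cong_def reducedD)
    qed
  qed
  also have "\<dots> = (of_nat (card characters) :: complex)"
    using one_mod_in_reduced by (simp add: sum.delta)
  finally show ?thesis by (metis of_nat_eq_iff)
qed

text \<open>As \<open>chi h'\<close> has modulus \<open>1\<close>, its conjugate is the value at an
  inverse \<open>g\<close> of \<open>h'\<close>. Each summand is then a single value
  \<open>chi (h * g)\<close>.\<close>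

lemma sum_characters_orthogonal:
  assumes "h \<in> R" "h' \<in> R"
  shows "(\<Sum>chi\<in>characters. chi h * cnj (chi h')) = (if h = h' then of_nat (Phi Q) else 0)"
proof -
  obtain g where g: "coprime g Q" "[h' * g = 1] (mod Q)" using reduced_inverse reducedD assms by blast
  have "chi h * cnj (chi h') = chi (h * g)" if "dirichlet_character Q chi" for chi
  proof -
    have "chi h' * chi g = 1"
      using that g(2) by (metis character_1 character_cong character_mult)
    moreover have "chi h' * cnj (chi h') = 1"
      using character_norm_sq[OF that, of h'] assms(2) by (simp add: principal_character_def reducedD)
    ultimately have "cnj (chi h') = chi g"
      by (metis mult_cancel_left mult_zero_left zero_neq_one)
    then show ?thesis by (simp add: character_mult[OF that])
  qed
  then have eq: "(\<Sum>chi\<in>characters. chi h * cnj (chi h')) = (\<Sum>chi\<in>characters. chi (h * g))"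
    by (intro sum.cong) auto
  show ?thesis
  proof (cases "h = h'")
    case True
    then have "(\<Sum>chi\<in>characters. chi (h * g)) = (\<Sum>chi\<in>characters. 1)"
      using g(2) by (intro sum.cong refl) (metis character_1 character_cong mem_Collect_eq)
    then show ?thesis using eq True by (simp add: card_characters)
  next
    case False
    have "\<not> [h * g = 1] (mod Q)"
    proof
      assume *: "[h * g = 1] (mod Q)"
      have "[h = h * (h' * g)] (mod Q)"
        using cong_scalar_left[OF g(2), of h] by (simp add: cong_sym)
      also have "h * (h' * g) = h' * (h * g)" by (simp add: ac_simps)
      also have "[h' * (h * g) = h'] (mod Q)" using cong_scalar_left[OF *, of h'] by simp
      finally show False using False assms by (simp add: cong_def reducedD)
    qed
    then show ?thesis
      using eq False sum_characters_eq_0[of "h * g"] g(1) assms(1)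
      by (simp add: coprime_mult_poly_iff reducedD)
  qed
qed

lemma parseval:
  fixes t :: "'a poly \<Rightarrow> real"
  shows "(\<Sum>chi\<in>characters. (cmod (\<Sum>h\<in>R. of_real (t h) * chi h))\<^sup>2) = real (Phi Q) * (\<Sum>h\<in>R. (t h)\<^sup>2)"
proof -
  have "complex_of_real (\<Sum>chi\<in>characters. (cmod (\<Sum>h\<in>R. of_real (t h) * chi h))\<^sup>2) =
      (\<Sum>chi\<in>characters. \<Sum>h\<in>R. \<Sum>h'\<in>R. of_real (t h * t h') * (chi h * cnj (chi h')))"
    by (simp add: complex_norm_square sum_product mult_ac del: of_real_power)
  also have "\<dots> = (\<Sum>h\<in>R. \<Sum>h'\<in>R. \<Sum>chi\<in>characters. of_real (t h * t h') * (chi h * cnj (chi h')))"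
    by (subst sum.swap, intro sum.cong refl, rule sum.swap)
  also have "\<dots> = (\<Sum>h\<in>R. \<Sum>h'\<in>R. if h = h' then of_real (t h * t h') * of_nat (Phi Q) else 0)"
    by (intro sum.cong refl)
       (simp only: sum_distrib_left[symmetric] sum_characters_orthogonal, simp)
  also have "\<dots> = of_real (real (Phi Q) * (\<Sum>h\<in>R. (t h)\<^sup>2))"
    by (simp add: sum.delta' sum_distrib_left power2_eq_square mult_ac)
  finally show ?thesis by (simp only: of_real_eq_iff)
qed

lemma sum_monic_divisors_by_residue:
  fixes w :: "'a poly \<Rightarrow> 'c::comm_monoid_add"
  assumes "f \<noteq> 0"
  shows "(\<Sum>d | is_monic d \<and> d dvd f \<and> coprime d Q. w d) =
     (\<Sum>h\<in>R. \<Sum>d | is_monic d \<and> d dvd f \<and> [d = h] (mod Q). w d)"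
proof -
  let ?S = "{d. is_monic d \<and> d dvd f \<and> coprime d Q}"
  have fin: "finite ?S"
    by (rule finite_subset[OF _ finite_monic_divisors[OF assms]]) auto
  have "(\<Sum>h\<in>R. sum w {d \<in> ?S. d mod Q = h}) = sum w ?S"
    by (rule sum.group[OF fin]) auto
  moreover have "{d \<in> ?S. d mod Q = h} = {d. is_monic d \<and> d dvd f \<and> [d = h] (mod Q)}"
    if "h \<in> R" for h
    using that reducedD[OF that] by (auto simp: cong_def)
  ultimately show ?thesis by simp
qed

text \<open>Variance is mean square minus squared mean. By \<open>parseval\<close> the mean square
  is the sum over all characters, and the principal character contributes exactly the squared
  mean.\<close>

lemma tau_variance_eq:
  assumes "f \<noteq> 0"
  shows "tau_variance f Q =
    (\<Sum>chi\<in>nonprincipal_characters Q. (cmod (divisor_sum chi f))\<^sup>2) / (real (Phi Q))\<^sup>2"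
proof -
  define t where "t h = real (tau_cong f h Q)" for h
  have fin: "finite {d. is_monic d \<and> d dvd f}" by (rule finite_monic_divisors[OF assms])
  have tau: "real (tau_coprime f Q) = (\<Sum>h\<in>R. t h)"
    using sum_monic_divisors_by_residue[OF assms, of "\<lambda>_. 1::real"]
    by (simp add: t_def tau_cong_def tau_coprime_def)
  have ds: "divisor_sum chi f = (\<Sum>h\<in>R. of_real (t h) * chi h)" if "dirichlet_character Q chi" for chi
  proof -
    have "divisor_sum chi f = (\<Sum>d | is_monic d \<and> d dvd f \<and> coprime d Q. chi d)"
      unfolding divisor_sum_def
      by (rule sum.mono_neutral_right[OF fin]) (use that character_eq_0_iff in auto)
    also have "\<dots> = (\<Sum>h\<in>R. \<Sum>d | is_monic d \<and> d dvd f \<and> [d = h] (mod Q). chi d)"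
      by (rule sum_monic_divisors_by_residue[OF assms])
    also have "\<dots> = (\<Sum>h\<in>R. \<Sum>d | is_monic d \<and> d dvd f \<and> [d = h] (mod Q). chi h)"
      using character_cong[OF that] by (intro sum.cong refl) auto
    also have "\<dots> = (\<Sum>h\<in>R. of_real (t h) * chi h)"
      by (simp add: t_def tau_cong_def)
    finally show ?thesis .
  qed
  let ?P = "real (Phi Q)" and ?m = "\<Sum>h\<in>R. t h"
  have princ: "(cmod (divisor_sum (principal_character Q) f))\<^sup>2 = ?m\<^sup>2"
  proof -
    have "divisor_sum (principal_character Q) f = of_real ?m"
      by (simp add: ds[OF principal_in_characters] principal_character_def reducedD)
    then show ?thesis by (metis norm_of_real power2_abs)
  qed
  have "nonprincipal_characters Q = characters - {principal_character Q}"
    by (auto simp: nonprincipal_characters_def)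
  then have "(\<Sum>chi\<in>nonprincipal_characters Q. (cmod (divisor_sum chi f))\<^sup>2)
      = (\<Sum>chi\<in>characters. (cmod (divisor_sum chi f))\<^sup>2) - ?m\<^sup>2"
    using finite_characters principal_in_characters princ by (simp add: sum_diff1)
  also have "(\<Sum>chi\<in>characters. (cmod (divisor_sum chi f))\<^sup>2) = ?P * (\<Sum>h\<in>R. (t h)\<^sup>2)"
    unfolding parseval[symmetric] by (intro sum.cong refl) (simp add: ds)
  finally have np: "(\<Sum>chi\<in>nonprincipal_characters Q. (cmod (divisor_sum chi f))\<^sup>2)
      = ?P * (\<Sum>h\<in>R. (t h)\<^sup>2) - ?m\<^sup>2" .
  have "(\<Sum>h\<in>R. (t h - ?m / ?P)\<^sup>2) = (\<Sum>h\<in>R. (t h)\<^sup>2 - 2 * (?m / ?P) * t h + (?m / ?P)\<^sup>2)"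
    by (simp add: power2_diff algebra_simps)
  also have "\<dots> = (\<Sum>h\<in>R. (t h)\<^sup>2) - 2 * (?m / ?P) * ?m + ?P * (?m / ?P)\<^sup>2"
    by (simp add: sum.distrib sum_subtractf sum_distrib_left Phi_eq)
  also have "\<dots> = (?P * (\<Sum>h\<in>R. (t h)\<^sup>2) - ?m\<^sup>2) / ?P"
    using Phi_pos by (simp add: field_simps power2_eq_square)
  finally show ?thesis
    unfolding tau_variance_def tau np by (simp add: t_def power2_eq_square)
qed

end

subsection \<open>Generating series over monic polynomials\<close>

text \<open>Generating series of a set graded by \<open>d\<close> with weights \<open>w\<close>.
  Where fibres are split or multiplied they are assumed finite, since a sum over an infinite set is
  \<open>0\<close>.\<close>

definition gen_fps :: "'b set \<Rightarrow> ('b \<Rightarrow> nat) \<Rightarrow> ('b \<Rightarrow> 'c::comm_ring_1) \<Rightarrow> 'c fps" where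
  "gen_fps A d w = Abs_fps (\<lambda>n. \<Sum>x | x \<in> A \<and> d x = n. w x)"

lemma gen_fps_nth: "fps_nth (gen_fps A d w) n = (\<Sum>x | x \<in> A \<and> d x = n. w x)"
  by (simp add: gen_fps_def)

lemma finite_fibres_Times:
  assumes "\<And>n. finite {x. x \<in> A \<and> d x = n}" "\<And>n. finite {y. y \<in> B \<and> e y = n}"
  shows "finite {p. p \<in> A \<times> B \<and> (case p of (x, y) \<Rightarrow> d x + e y) = (n::nat)}"
proof (rule finite_subset)
  show "{p. p \<in> A \<times> B \<and> (case p of (x, y) \<Rightarrow> d x + e y) = n}
      \<subseteq> (\<Union>i\<in>{..n}. {x. x \<in> A \<and> d x = i} \<times> {y. y \<in> B \<and> e y = n - i})"
    by auto
qed (use assms in auto)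

lemma gen_fps_mult:
  assumes "\<And>n. finite {x. x \<in> A \<and> d x = n}" "\<And>n. finite {y. y \<in> B \<and> e y = n}"
  shows "gen_fps A d w * gen_fps B e v = gen_fps (A \<times> B) (\<lambda>(x, y). d x + e y) (\<lambda>(x, y). w x * v y)"
proof (rule fps_ext)
  fix n
  let ?S = "{p. p \<in> A \<times> B \<and> (case p of (x, y) \<Rightarrow> d x + e y) = n}"
  let ?A = "\<lambda>n. {x. x \<in> A \<and> d x = n}" and ?B = "\<lambda>n. {y. y \<in> B \<and> e y = n}"
  have "(\<Sum>p\<in>?S. case p of (x, y) \<Rightarrow> w x * v y)
      = (\<Sum>i\<in>{0..n}. \<Sum>p | p \<in> ?S \<and> d (fst p) = i. case p of (x, y) \<Rightarrow> w x * v y)"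
    by (rule sum.group[symmetric]) (use finite_fibres_Times[OF assms] in auto)
  also have "\<dots> = (\<Sum>i\<in>{0..n}. \<Sum>p\<in>?A i \<times> ?B (n - i). case p of (x, y) \<Rightarrow> w x * v y)"
    by (intro sum.cong refl) auto
  also have "\<dots> = (\<Sum>i\<in>{0..n}. sum w (?A i) * sum v (?B (n - i)))"
    by (simp add: sum_product sum.cartesian_product)
  finally show "fps_nth (gen_fps A d w * gen_fps B e v) n
      = fps_nth (gen_fps (A \<times> B) (\<lambda>(x, y). d x + e y) (\<lambda>(x, y). w x * v y)) n"
    by (simp add: fps_mult_nth gen_fps_nth)
qed

lemma gen_fps_reindex:
  assumes "bij_betw \<phi> A B" "\<And>x. x \<in> A \<Longrightarrow> e (\<phi> x) = d x" "\<And>x. x \<in> A \<Longrightarrow> v (\<phi> x) = w x"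
  shows "gen_fps A d w = gen_fps B e v"
proof (rule fps_ext)
  fix n
  have "bij_betw \<phi> {x. x \<in> A \<and> d x = n} {y. y \<in> B \<and> e y = n}"
    using assms(1,2) by (auto simp: bij_betw_def inj_on_def image_iff)
  from sum.reindex_bij_betw[OF this, of v] show "fps_nth (gen_fps A d w) n = fps_nth (gen_fps B e v) n"
    using assms(3) by (simp add: gen_fps_nth)
qed

lemma gen_fps_disjoint_union:
  assumes "A = B \<union> C" "B \<inter> C = {}" "\<And>n. finite {x. x \<in> A \<and> d x = n}"
  shows "gen_fps A d w = gen_fps B d w + gen_fps C d w"
proof (rule fps_ext)
  fix n
  have *: "{x. x \<in> A \<and> d x = n} = {x. x \<in> B \<and> d x = n} \<union> {x. x \<in> C \<and> d x = n}"
    using assms(1) by auto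
  have "finite {x. x \<in> B \<and> d x = n}" "finite {x. x \<in> C \<and> d x = n}"
    using assms(3)[of n] unfolding * by auto
  then show "fps_nth (gen_fps A d w) n = fps_nth (gen_fps B d w + gen_fps C d w) n"
    unfolding gen_fps_nth fps_add_nth * using assms(2) by (intro sum.union_disjoint) auto
qed

lemma gen_fps_Sigma:
  assumes "\<And>n. finite {x. x \<in> A \<and> d x = n}" "\<And>x. x \<in> A \<Longrightarrow> finite (B x)"
  shows "gen_fps A d (\<lambda>x. \<Sum>y\<in>B x. w x y) = gen_fps (Sigma A B) (\<lambda>(x, y). d x) (\<lambda>(x, y). w x y)"
proof (rule fps_ext)
  fix n
  have "{p. p \<in> Sigma A B \<and> (case p of (x, y) \<Rightarrow> d x) = n} = Sigma {x. x \<in> A \<and> d x = n} B" by auto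
  then show "fps_nth (gen_fps A d (\<lambda>x. \<Sum>y\<in>B x. w x y)) n
      = fps_nth (gen_fps (Sigma A B) (\<lambda>(x, y). d x) (\<lambda>(x, y). w x y)) n"
    using assms by (simp add: gen_fps_nth sum.Sigma)
qed

lemma gen_fps_support:
  assumes "\<And>n. finite {x. x \<in> A \<and> d x = n}" "B \<subseteq> A" "\<And>x. x \<in> A - B \<Longrightarrow> w x = 0"
    "\<And>x. x \<in> B \<Longrightarrow> w x = v x"
  shows "gen_fps A d w = gen_fps B d v"
proof (rule fps_ext)
  fix n
  have "(\<Sum>x | x \<in> A \<and> d x = n. w x) = (\<Sum>x | x \<in> B \<and> d x = n. w x)"
    by (rule sum.mono_neutral_right) (use assms in auto)
  then show "fps_nth (gen_fps A d w) n = fps_nth (gen_fps B d v) n"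
    using assms(4) by (simp add: gen_fps_nth)
qed

lemma gen_fps_const:
  assumes "finite A" "\<And>x. x \<in> A \<Longrightarrow> d x = k" "\<And>x. x \<in> A \<Longrightarrow> w x = c"
  shows "gen_fps A d w = fps_const (of_nat (card A) * c) * fps_X ^ k"
proof (rule fps_ext)
  fix n
  show "fps_nth (gen_fps A d w) n = fps_nth (fps_const (of_nat (card A) * c) * fps_X ^ k) n"
  proof (cases "n = k")
    case True
    then have "{x. x \<in> A \<and> d x = n} = A" using assms by auto
    then show ?thesis using True assms by (simp add: gen_fps_nth)
  next
    case False
    then have e: "{x. x \<in> A \<and> d x = n} = {}" using assms by auto
    show ?thesis unfolding gen_fps_nth e using False by simp
  qed
qed

section \<open>The zeta series of monic polynomials and the removal of primes\<close>

abbreviation monics :: "'a::{finite,field} poly set" where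
  "monics \<equiv> {f. is_monic f}"

lemma finite_fibre_monics:
  assumes "k > 0"
  shows "finite {f :: 'a::{finite,field} poly. f \<in> A \<and> k * degree f = n}"
proof (rule finite_subset)
  show "{f. f \<in> A \<and> k * degree f = n} \<subseteq> {f. degree f \<le> n}"
    using assms by (auto simp: Suc_le_eq)
qed (rule finite_degree_le)

lemma monic_mult: "is_monic f \<Longrightarrow> is_monic g \<Longrightarrow> is_monic (f * g)"
  by (simp add: lead_coeff_mult)

lemma monic_factor: "is_monic f \<Longrightarrow> is_monic (f * g) \<Longrightarrow> is_monic g"
  by (simp add: lead_coeff_mult)

lemma monic_dvd_antisym:
  fixes f g :: "'a::{finite,field} poly"
  assumes "is_monic f" "is_monic g" "f dvd g" "g dvd f"
  shows "f = g"
proof -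
  obtain k where k: "g = f * k" using assms(3) by blast
  have "is_monic k" using monic_factor assms k by blast
  have "degree f = degree g"
    using assms by (intro antisym dvd_imp_degree_le) auto
  then have "degree k = 0"
    using k degree_mult_eq[OF monic_nonzero[OF assms(1)] monic_nonzero[OF \<open>is_monic k\<close>]] by simp
  then show ?thesis using k \<open>is_monic k\<close> by (auto elim!: degree_eq_zeroE)
qed

text \<open>Splitting off the constant coefficient writes a monic polynomial of positive degree as
  \<open>pCons c g\<close> with \<open>c\<close> arbitrary and \<open>g\<close> monic, so the series
  \<open>Z\<close> satisfies \<open>Z = 1 + q X^k Z\<close>. The scale \<open>k\<close> realises the
  substitution of \<open>u^k\<close> for \<open>u\<close>; the cases \<open>1\<close> and
  \<open>2\<close> are used.\<close>

lemma zeta_fps: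
  assumes "k > 0"
  shows "gen_fps (monics :: 'a::{finite,field} poly set) (\<lambda>f. k * degree f) (\<lambda>_. 1 :: 'c::comm_ring_1)
    * (1 - of_nat CARD('a) * fps_X ^ k) = 1"
proof -
  let ?M = "monics :: 'a poly set" and ?d = "\<lambda>f :: 'a poly. k * degree f"
  let ?Z = "gen_fps ?M ?d (\<lambda>_. 1 :: 'c)"
  let ?P = "{f \<in> ?M. degree f > 0}"
  have "f = 1 \<or> degree f > 0" if "is_monic f" for f :: "'a poly"
    using that by (cases "degree f = 0") (auto elim!: degree_eq_zeroE)
  then have "?M = {1} \<union> ?P" by auto
  then have "?Z = gen_fps {1} ?d (\<lambda>_. 1) + gen_fps ?P ?d (\<lambda>_. 1)"
    by (intro gen_fps_disjoint_union finite_fibre_monics[OF assms]) auto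
  also have "gen_fps {1} ?d (\<lambda>_. 1 :: 'c) = 1"
    by (subst gen_fps_const[where k = 0 and c = 1]) auto
  also have "gen_fps ?P ?d (\<lambda>_. 1)
      = gen_fps (UNIV \<times> ?M) (\<lambda>(c :: 'a, f). k + ?d f) (\<lambda>(c, f). 1 * (1 :: 'c))"
  proof (rule gen_fps_reindex[symmetric])
    show "bij_betw (\<lambda>(c, f). pCons c f) (UNIV \<times> ?M) ?P"
      unfolding bij_betw_def
    proof
      show "(\<lambda>(c, f). pCons c f) ` (UNIV \<times> ?M) = ?P"
      proof safe
        fix f :: "'a poly" assume f: "is_monic f" "degree f > 0"
        obtain c g where "f = pCons c g" by (cases f)
        then show "f \<in> (\<lambda>(c, f). pCons c f) ` (UNIV \<times> ?M)"
          using f by (cases "g = 0") auto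
      qed auto
    qed (auto simp: inj_on_def)
  qed auto
  also have "\<dots> = gen_fps (UNIV :: 'a set) (\<lambda>_. k) (\<lambda>_. 1 :: 'c) * ?Z"
    by (rule gen_fps_mult[OF _ finite_fibre_monics[OF assms], symmetric]) simp
  also have "gen_fps (UNIV :: 'a set) (\<lambda>_. k) (\<lambda>_. 1 :: 'c) = of_nat CARD('a) * fps_X ^ k"
    by (subst gen_fps_const[where k = k and c = 1]) (auto simp: fps_of_nat)
  finally show ?thesis by (simp add: algebra_simps)
qed

text \<open>A nonunit divisor of least degree is irreducible; dividing by its leading coefficient
  makes it monic.\<close>

lemma monic_irreducible_divisor:
  fixes g :: "'a::{finite,field} poly"
  assumes "g \<noteq> 0" "\<not> is_unit g"
  shows "\<exists>P. is_monic P \<and> irreducible P \<and> P dvd g"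
proof -
  obtain p where p: "p dvd g" "\<not> is_unit p"
    and min: "\<And>p'. p' dvd g \<Longrightarrow> \<not> is_unit p' \<Longrightarrow> degree p \<le> degree p'"
    using exists_least_iff[of "\<lambda>n. \<exists>p. p dvd g \<and> \<not> is_unit p \<and> degree p = n"] assms
    by (metis dvd_refl linorder_not_less)
  have p0: "p \<noteq> 0" using p assms by auto
  have irr: "irreducible p"
  proof (rule irreducibleI)
    fix a b assume ab: "p = a * b"
    show "is_unit a \<or> is_unit b"
    proof (rule disjCI)
      assume "\<not> is_unit b"
      then have "degree p \<le> degree b" using min[of b] ab p by (meson dvd_trans dvd_triv_right)
      then show "is_unit a"
        using ab p0 degree_mult_eq[of a b] by (auto simp: is_unit_iff_degree)
    qed
  qed (use p p0 in auto)
  define P where "P = smult (inverse (lead_coeff p)) p"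
  have P: "P = [:inverse (lead_coeff p):] * p" by (simp add: P_def)
  moreover have u: "is_unit [:inverse (lead_coeff p):]"
    using p0 by (simp add: is_unit_const_poly_iff dvd_field_iff)
  ultimately have "irreducible P" "P dvd g"
    using irr p irreducible_mult_unit_left[OF u] mult_unit_dvd_iff'[OF u] by metis+
  moreover have "is_monic P" using p0 by (simp add: P_def)
  ultimately show ?thesis by blast
qed

definition sieved :: "'a::{finite,field} poly set \<Rightarrow> 'a poly set" where
  "sieved S = {f. is_monic f \<and> (\<forall>P\<in>S. \<not> P dvd f)}"

text \<open>Induction on the set of primes: the polynomials in \<open>sieved S\<close> that are
  divisible by a new prime \<open>P\<close> are exactly \<open>P\<close> times
  \<open>sieved S\<close>, so excluding them multiplies the series by
  \<open>1 - X^(k deg P)\<close>.\<close>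

lemma gen_fps_sieved:
  fixes S :: "'a::{finite,field} poly set"
  assumes "k > 0" "finite S" "\<And>P. P \<in> S \<Longrightarrow> is_monic P \<and> irreducible P"
  shows "gen_fps (sieved S) (\<lambda>f. k * degree f) (\<lambda>_. 1 :: 'c::comm_ring_1)
    = gen_fps monics (\<lambda>f :: 'a poly. k * degree f) (\<lambda>_. 1) * (\<Prod>P\<in>S. 1 - fps_X ^ (k * degree P))"
  using assms(2,3)
proof (induction S)
  case empty
  then show ?case by (simp add: sieved_def)
next
  case (insert P S)
  let ?d = "\<lambda>f :: 'a poly. k * degree f"
  have P: "is_monic P" "irreducible P" using insert.prems by auto
  have P0: "P \<noteq> 0" using P by auto
  have "sieved S = sieved (insert P S) \<union> {f \<in> sieved S. P dvd f}"
    by (auto simp: sieved_def)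
  then have "gen_fps (sieved S) ?d (\<lambda>_. 1 :: 'c) =
      gen_fps (sieved (insert P S)) ?d (\<lambda>_. 1) + gen_fps {f \<in> sieved S. P dvd f} ?d (\<lambda>_. 1)"
    by (rule gen_fps_disjoint_union[OF _ _ finite_fibre_monics[OF assms(1)]]) (auto simp: sieved_def)
  also have "gen_fps {f \<in> sieved S. P dvd f} ?d (\<lambda>_. 1 :: 'c)
      = gen_fps ({P} \<times> sieved S) (\<lambda>(p, f). ?d p + ?d f) (\<lambda>(p, f). 1 * 1)"
  proof (rule gen_fps_reindex[symmetric])
    show "bij_betw (\<lambda>(p, f). p * f) ({P} \<times> sieved S) {f \<in> sieved S. P dvd f}"
      unfolding bij_betw_def
    proof
      \<comment> \<open>A prime of \<open>S\<close> dividing \<open>P * f\<close> but not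
        \<open>f\<close> divides \<open>P\<close>, hence equals \<open>P\<close> as both are monic
        and irreducible; but \<open>P\<close> is new.\<close>
      have mem: "P * f \<in> sieved S" if "f \<in> sieved S" for f
      proof -
        have "\<not> P' dvd P * f" if "P' \<in> S" for P'
        proof
          assume "P' dvd P * f"
          have P': "is_monic P'" "irreducible P'" using insert.prems that by auto
          then have "prime_elem P'" by (intro field_poly_irreducible_imp_prime)
          then have "P' dvd P"
            using \<open>P' dvd P * f\<close> \<open>f \<in> sieved S\<close> that prime_elem_dvd_mult_iff
            by (auto simp: sieved_def)
          then have "P dvd P'" using P P' by (meson irreducibleD' irreducible_not_unit)
          then have "P = P'" using monic_dvd_antisym P P' \<open>P' dvd P\<close> by blast
          then show False using that insert.hyps by blast
        qed
        then show ?thesis using that P by (auto simp: sieved_def intro: monic_mult)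
      qed
      show "(\<lambda>(p, f). p * f) ` ({P} \<times> sieved S) = {f \<in> sieved S. P dvd f}"
      proof (intro equalityI subsetI)
        fix x assume "x \<in> {f \<in> sieved S. P dvd f}"
        then obtain f where "x = P * f" "P * f \<in> sieved S" by blast
        then show "x \<in> (\<lambda>(p, f). p * f) ` ({P} \<times> sieved S)"
          using P monic_factor[of P f] by (intro image_eqI[of _ _ "(P, f)"]) (auto simp: sieved_def)
      qed (use mem in auto)
    qed (use P0 in \<open>auto simp: inj_on_def\<close>)
    show "\<And>x. x \<in> {P} \<times> sieved S \<Longrightarrow>
        ?d (case x of (p, f) \<Rightarrow> p * f) = (case x of (p, f) \<Rightarrow> ?d p + ?d f)"
      using P0 by (auto simp: sieved_def degree_mult_eq monic_nonzero distrib_left)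
  qed auto
  also have "\<dots> = gen_fps {P} ?d (\<lambda>_. 1 :: 'c) * gen_fps (sieved S) ?d (\<lambda>_. 1)"
    by (intro gen_fps_mult[symmetric] finite_fibre_monics[OF assms(1)])
  also have "gen_fps {P} ?d (\<lambda>_. 1 :: 'c) = fps_X ^ (k * degree P)"
    by (subst gen_fps_const[where k = "k * degree P" and c = 1]) auto
  finally have "gen_fps (sieved (insert P S)) ?d (\<lambda>_. 1 :: 'c)
      = gen_fps (sieved S) ?d (\<lambda>_. 1) * (1 - fps_X ^ (k * degree P))"
    by (simp add: algebra_simps)
  then show ?case using insert by (simp add: mult_ac)
qed

section \<open>Extraction of gcds from pairs of monic polynomials\<close>

lemma coprime_factorization:
  fixes d e :: "'a::{finite,field} poly"
  assumes "is_monic d" "is_monic e"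
  obtains g a b where "is_monic g" "is_monic a" "is_monic b" "coprime a b" "d = g * a" "e = g * b"
proof -
  obtain g x y where g: "g dvd d" "g dvd e" "g = x * d + y * e" using poly_bezout by blast
  have g0: "g \<noteq> 0" using g assms by auto
  define c where "c = inverse (lead_coeff g)"
  define g' where "g' = smult c g"
  have c0: "c \<noteq> 0" using g0 by (simp add: c_def)
  have "is_monic g'" using g0 by (simp add: g'_def c_def)
  moreover obtain a b where ab: "d = g' * a" "e = g' * b"
    using g(1,2) c0 by (metis g'_def dvdE smult_dvd_iff)
  moreover have "g' = smult c x * d + smult c y * e"
    using g(3) unfolding g'_def by (simp add: smult_add_right)
  \<comment> \<open>Cancelling the monic gcd \<open>g'\<close> from its own Bezout identity gives
    one for the cofactors.\<close>
  then have "g' * (smult c x * a + smult c y * b) = g' * 1"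
    using ab by (simp add: algebra_simps)
  then have "smult c x * a + smult c y * b = 1"
    using \<open>is_monic g'\<close> by (metis mult_cancel_left monic_nonzero)
  then have "coprime a b" unfolding coprime_poly_iff_bezout by blast
  ultimately show ?thesis using that[of g' a b] assms monic_factor by blast
qed

text \<open>A Bezout identity for \<open>a'\<close> and \<open>b'\<close> exhibits \<open>g'\<close>
  as a multiple of \<open>g\<close>, and conversely by symmetry; monic polynomials dividing each
  other coincide.\<close>

lemma coprime_factorization_unique:
  fixes g :: "'a::{finite,field} poly"
  assumes "is_monic g" "is_monic g'" "coprime a b" "coprime a' b'" "g * a = g' * a'" "g * b = g' * b'"
  shows "g = g' \<and> a = a' \<and> b = b'"
proof -
  have "g dvd g'" if cop: "coprime a' b'" and eqs: "g * a = g' * a'" "g * b = g' * b'" for g g' a a' b b' :: "'a poly"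
  proof -
    obtain x y where "x * a' + y * b' = 1" using cop coprime_poly_iff_bezout by blast
    then have "g' = g' * (x * a' + y * b')" by simp
    also have "\<dots> = x * (g' * a') + y * (g' * b')" by (simp add: algebra_simps)
    also have "\<dots> = g * (x * a + y * b)" unfolding eqs[symmetric] by (simp add: algebra_simps)
    finally show ?thesis by (metis dvd_triv_left)
  qed
  from this[of a' b' g a g' b] this[of a b g' a' g b'] have "g = g'"
    using assms by (intro monic_dvd_antisym) auto
  moreover have "g \<noteq> 0" using assms by auto
  ultimately show ?thesis using assms by auto
qed

definition coprime_pairs :: "('a::{finite,field} poly \<times> 'a poly) set" where
  "coprime_pairs = {(a, b). is_monic a \<and> is_monic b \<and> coprime a b}"

text \<open>The degrees of the pair add up to \<open>2 deg g + deg a + deg b\<close>: here the gcd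
  is counted twice.\<close>

lemma bij_betw_monic_pairs:
  "bij_betw (\<lambda>(g, (a, b)). (g * a, g * b)) (monics \<times> coprime_pairs)
     (monics \<times> (monics :: 'a::{finite,field} poly set))"
  unfolding bij_betw_def
proof
  show "inj_on (\<lambda>(g, (a, b)). (g * a, g * b)) (monics \<times> (coprime_pairs :: ('a poly \<times> 'a poly) set))"
  proof (rule inj_onI)
    fix x y assume *: "x \<in> monics \<times> (coprime_pairs :: ('a poly \<times> 'a poly) set)" "y \<in> monics \<times> coprime_pairs"
      "(case x of (g, (a, b)) \<Rightarrow> (g * a, g * b)) = (case y of (g, (a, b)) \<Rightarrow> (g * a, g * b))"
    obtain g a b g' a' b' where "x = (g, a, b)" "y = (g', a', b')"
      by (metis surj_pair)
    then show "x = y"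
      using * coprime_factorization_unique[of g g' a b a' b'] by (auto simp: coprime_pairs_def)
  qed
  show "(\<lambda>(g, (a, b)). (g * a, g * b)) ` (monics \<times> coprime_pairs) = monics \<times> (monics :: 'a poly set)"
  proof (intro equalityI subsetI)
    fix p :: "'a poly \<times> 'a poly" assume "p \<in> monics \<times> monics"
    then obtain d e where p: "p = (d, e)" "is_monic d" "is_monic e" by auto
    from p(2,3) obtain g a b
      where "is_monic g" "is_monic a" "is_monic b" "coprime a b" "d = g * a" "e = g * b"
      by (rule coprime_factorization)
    then show "p \<in> (\<lambda>(g, (a, b)). (g * a, g * b)) ` (monics \<times> coprime_pairs)"
      unfolding p by (intro image_eqI[of _ _ "(g, (a, b))"]) (auto simp: coprime_pairs_def)
  qed (auto simp: coprime_pairs_def intro: monic_mult)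
qed

text \<open>The least common multiple of \<open>g a\<close> and \<open>g b\<close> is
  \<open>g a b\<close>, so \<open>f\<close> is this times a free cofactor \<open>m\<close>. In
  contrast to arbitrary pairs, the gcd is counted once in \<open>deg f\<close>.\<close>

lemma bij_betw_divisor_pairs:
  "bij_betw (\<lambda>(m, (g, (a, b))). (g * a * b * m, (g * a, g * b))) (monics \<times> (monics \<times> coprime_pairs))
     (SIGMA f:monics. {d. is_monic d \<and> d dvd f} \<times> {e :: 'a::{finite,field} poly. is_monic e \<and> e dvd f})"
  (is "bij_betw ?\<phi> ?A ?B")
  unfolding bij_betw_def
proof
  show "inj_on ?\<phi> ?A"
  proof (rule inj_onI)
    fix x y assume "x \<in> ?A" "y \<in> ?A" "?\<phi> x = ?\<phi> y"
    moreover obtain m g a b m' g' a' b' where "x = (m, g, a, b)" "y = (m', g', a', b')"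
      by (metis surj_pair)
    ultimately have *: "is_monic g" "is_monic g'" "coprime a b" "coprime a' b'"
        "g * a = g' * a'" "g * b = g' * b'" "g * a * b * m = g' * a' * b' * m'"
        "is_monic a" "is_monic b" and xy: "x = (m, g, a, b)" "y = (m', g', a', b')"
      by (auto simp only: mem_Times_iff fst_conv snd_conv prod.case prod.inject mem_Collect_eq coprime_pairs_def)
    have eq: "g = g' \<and> a = a' \<and> b = b'" by (rule coprime_factorization_unique) fact+
    moreover have "g * a * b \<noteq> 0" using * by auto
    ultimately have "m = m'" using *(7) by auto
    with eq xy show "x = y" by simp
  qed
  show "?\<phi> ` ?A = ?B"
  proof (intro equalityI subsetI)
    fix x assume "x \<in> ?B"
    then obtain f d e where x: "x = (f, (d, e))" "is_monic f" "is_monic d" "d dvd f" "is_monic e" "e dvd f"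
      by auto
    from x(3,5) obtain g a b
      where *: "is_monic g" "is_monic a" "is_monic b" "coprime a b" "d = g * a" "e = g * b"
      by (rule coprime_factorization)
    obtain k l where kl: "f = g * a * k" "f = g * b * l" using x * by (metis dvdE)
    \<comment> \<open>Comparing the two factorizations of \<open>f\<close> gives
      \<open>a k = b l\<close>; coprimality then puts \<open>a\<close> into
      \<open>l\<close>.\<close>
    then have "g * (a * k) = g * (b * l)" by (metis mult.assoc)
    then have "a * k = b * l" using * by (metis mult_cancel_left monic_nonzero)
    then have "a dvd l" using *(4) coprime_dvd_mult_poly by (metis dvd_triv_left)
    then obtain m where "l = a * m" by blast
    then have f: "f = g * a * b * m" using kl by (simp add: mult_ac)
    moreover have "is_monic m" using * x f monic_factor[of "g * a * b" m] monic_mult by blast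
    ultimately show "x \<in> ?\<phi> ` ?A"
      using * x by (intro image_eqI[of _ _ "(m, g, a, b)"]) (auto simp: coprime_pairs_def)
  next
    fix x assume "x \<in> ?\<phi> ` ?A"
    then obtain m g a b where x: "x = (g * a * b * m, g * a, g * b)"
        "is_monic m" "is_monic g" "is_monic a" "is_monic b" by (auto simp: coprime_pairs_def)
    have "g * b dvd g * a * b * m" by (metis dvd_triv_left mult.assoc mult.commute)
    moreover have "g * a dvd g * a * b * m" by (simp add: mult.assoc)
    ultimately show "x \<in> ?B" using x by (auto intro!: monic_mult)
  qed
qed

section \<open>The functional identity between \<open>F\<close> and the L-series\<close>

abbreviation L_fps :: "('a::{finite,field} poly \<Rightarrow> complex) \<Rightarrow> complex fps" where
  "L_fps chi \<equiv> gen_fps monics degree chi"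

definition norm_divisor_sum_fps :: "('a::{finite,field} poly \<Rightarrow> complex) \<Rightarrow> complex fps" where
  "norm_divisor_sum_fps chi = gen_fps monics degree (\<lambda>f. divisor_sum chi f * cnj (divisor_sum chi f))"

context poly_modulus
begin

lemma finite_monic_prime_divisors [simp]: "finite (monic_prime_divisors Q)"
proof (rule finite_subset)
  show "monic_prime_divisors Q \<subseteq> {d. is_monic d \<and> d dvd Q}"
    by (auto simp: monic_prime_divisors_def)
qed (rule finite_monic_divisors[OF Q_nonzero])

lemma sieved_prime_divisors: "sieved (monic_prime_divisors Q) = {f. is_monic f \<and> coprime f Q}"
proof -
  have "coprime f Q \<longleftrightarrow> (\<forall>P\<in>monic_prime_divisors Q. \<not> P dvd f)" for f
  proof
    assume cop: "coprime f Q"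
    show "\<forall>P\<in>monic_prime_divisors Q. \<not> P dvd f"
    proof
      fix P assume "P \<in> monic_prime_divisors Q"
      then have "irreducible P" "P dvd Q" by (simp_all add: monic_prime_divisors_def)
      then show "\<not> P dvd f"
        using coprime_common_divisor[OF cop, of P] irreducible_not_unit by blast
    qed
  next
    assume *: "\<forall>P\<in>monic_prime_divisors Q. \<not> P dvd f"
    show "coprime f Q"
    proof (rule coprimeI)
      fix d assume d: "d dvd f" "d dvd Q"
      show "is_unit d"
      proof (rule ccontr)
        assume "\<not> is_unit d"
        moreover have "d \<noteq> 0" using d Q_nonzero by auto
        ultimately obtain P where "is_monic P" "irreducible P" "P dvd d"
          using monic_irreducible_divisor by blast
        with * d show False using dvd_trans by (auto simp: monic_prime_divisors_def)
      qed
    qed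
  qed
  then show ?thesis by (auto simp: sieved_def)
qed

text \<open>By \<open>sieved_prime_divisors\<close>, being coprime to \<open>Q\<close> means
  avoiding its monic primes, so this is the zeta series with their Euler factors removed.\<close>

lemma principal_fps:
  assumes "k > 0"
  shows "gen_fps monics (\<lambda>f. k * degree f) (principal_character Q) =
    gen_fps monics (\<lambda>f :: 'a poly. k * degree f) (\<lambda>_. 1)
      * (\<Prod>P\<in>monic_prime_divisors Q. 1 - fps_X ^ (k * degree P))"
proof -
  have "gen_fps monics (\<lambda>f. k * degree f) (principal_character Q)
      = gen_fps (sieved (monic_prime_divisors Q)) (\<lambda>f. k * degree f) (\<lambda>_. 1)"
    unfolding sieved_prime_divisors using finite_fibre_monics[OF assms, of monics]
    by (intro gen_fps_support) (auto simp: principal_character_def)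
  also have "\<dots> = gen_fps monics (\<lambda>f :: 'a poly. k * degree f) (\<lambda>_. 1)
      * (\<Prod>P\<in>monic_prime_divisors Q. 1 - fps_X ^ (k * degree P))"
    by (rule gen_fps_sieved[OF assms finite_monic_prime_divisors]) (auto simp: monic_prime_divisors_def)
  finally show ?thesis .
qed

text \<open>Let \<open>C\<close> be the series of coprime pairs, \<open>Z\<close> the zeta series
  and \<open>Y\<close> that of the principal character. The two bijections give
  \<open>F(u) = Z(u) Y(u) C(u)\<close> and \<open>Y(u^2) C(u)\<close> for the product of the
  L-series. With \<open>Y\<close> expressed through \<open>Z\<close>, the same \<open>C\<close>
  stands on both sides, and no closed form of it is required.\<close>

lemma norm_divisor_sum_fps_eq:
  assumes chi: "dirichlet_character Q chi"
  shows "norm_divisor_sum_fps chi * (1 - of_nat CARD('a) * fps_X)\<^sup>2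
      * (\<Prod>P\<in>monic_prime_divisors Q. 1 + fps_X ^ degree P)
    = (1 - of_nat CARD('a) * fps_X ^ 2) * (L_fps chi * L_fps (\<lambda>f. cnj (chi f)))"
proof -
  let ?Z = "\<lambda>k. gen_fps monics (\<lambda>f :: 'a poly. k * degree f) (\<lambda>_. 1 :: complex)"
  let ?Y = "\<lambda>k. gen_fps monics (\<lambda>f. k * degree f) (principal_character Q)"
  let ?N = "\<lambda>k. \<Prod>P\<in>monic_prime_divisors Q. 1 - fps_X ^ (k * degree P) :: complex fps"
  let ?D = "\<Prod>P\<in>monic_prime_divisors Q. 1 + fps_X ^ degree P :: complex fps"
  let ?C = "gen_fps coprime_pairs (\<lambda>(a, b). degree a + degree b) (\<lambda>(a, b). chi a * cnj (chi b))"
  have fin: "finite {f :: 'a poly. f \<in> A \<and> degree f = n}" for A n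
    using finite_fibre_monics[of 1] by simp
  have fin2: "finite {p. p \<in> coprime_pairs \<and> (case p of (a, b) \<Rightarrow> degree (a :: 'a poly) + degree (b :: 'a poly)) = n}" for n
    by (rule finite_subset[OF _ finite_fibres_Times[of monics degree monics degree n, OF fin fin]])
       (auto simp: coprime_pairs_def)
  have weight: "chi (g * a) * cnj (chi (g * b)) = principal_character Q g * (chi a * cnj (chi b))" for g a b
    using character_norm_sq[OF chi, of g] by (simp add: character_mult[OF chi] mult_ac)
  \<comment> \<open>The factorization \<open>1 - v^2 = (1 - v)(1 + v)\<close> with
    \<open>v = u^(deg P)\<close>; this is where the local factors \<open>1 + u^(deg P)\<close>
    arise.\<close>
  have N2: "?N 2 = ?N 1 * ?D"
    by (simp add: prod.distrib[symmetric] algebra_simps power_mult power2_eq_square flip: power_add)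
  have "norm_divisor_sum_fps chi = gen_fps monics degree
      (\<lambda>f. \<Sum>(d, e)\<in>{d. is_monic d \<and> d dvd f} \<times> {e. is_monic e \<and> e dvd f}. chi d * cnj (chi e))"
    by (simp add: norm_divisor_sum_fps_def divisor_sum_def sum_product sum.cartesian_product)
  also have "\<dots> = gen_fps (SIGMA f:monics. {d. is_monic d \<and> d dvd f} \<times> {e. is_monic e \<and> e dvd f})
      (\<lambda>(f, p). degree f) (\<lambda>(f, p). case p of (d, e) \<Rightarrow> chi d * cnj (chi e))"
    by (intro gen_fps_Sigma fin finite_cartesian_product finite_monic_divisors) auto
  also have "\<dots> = gen_fps ((monics :: 'a poly set) \<times> (monics \<times> coprime_pairs))
      (\<lambda>(m, p). degree m + (case p of (g, q) \<Rightarrow> 1 * degree g + (case q of (a, b) \<Rightarrow> degree a + degree b)))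
      (\<lambda>(m, p). 1 * (case p of (g, q) \<Rightarrow> principal_character Q g * (case q of (a, b) \<Rightarrow> chi a * cnj (chi b))))"
    by (rule gen_fps_reindex[OF bij_betw_divisor_pairs, symmetric])
       (auto simp: coprime_pairs_def degree_mult_eq monic_nonzero weight)
  also have "\<dots> = gen_fps (monics :: 'a poly set) degree (\<lambda>_. 1) * (?Y 1 * ?C)"
    unfolding gen_fps_mult[OF finite_fibre_monics[OF zero_less_one] fin2]
    by (rule gen_fps_mult[symmetric, OF fin
          finite_fibres_Times[OF finite_fibre_monics[OF zero_less_one] fin2]])
  finally have F: "norm_divisor_sum_fps chi = ?Z 1 * (?Y 1 * ?C)" by simp
  have "L_fps chi * L_fps (\<lambda>f. cnj (chi f)) = gen_fps (monics \<times> monics)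
      (\<lambda>(d, e). degree d + degree e) (\<lambda>(d, e). chi d * cnj (chi e))"
    using fin by (intro gen_fps_mult) auto
  also have "\<dots> = gen_fps (monics \<times> coprime_pairs)
      (\<lambda>(g, q). 2 * degree g + (case q of (a, b) \<Rightarrow> degree a + degree b))
      (\<lambda>(g, q). principal_character Q g * (case q of (a, b) \<Rightarrow> chi a * cnj (chi b)))"
    by (rule gen_fps_reindex[OF bij_betw_monic_pairs, symmetric])
       (auto simp: coprime_pairs_def degree_mult_eq monic_nonzero weight)
  also have "\<dots> = ?Y 2 * ?C"
    by (rule gen_fps_mult[OF finite_fibre_monics[OF zero_less_numeral] fin2, symmetric])
  finally have LL: "L_fps chi * L_fps (\<lambda>f. cnj (chi f)) = ?Y 2 * ?C" .
  let ?q = "of_nat CARD('a) :: complex fps"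
  have Z1: "?Z 1 * (1 - ?q * fps_X) = 1" using zeta_fps[where 'a='a, of 1] by simp
  have Z2: "?Z 2 * (1 - ?q * fps_X ^ 2) = 1" using zeta_fps[where 'a='a, of 2] by simp
  have "norm_divisor_sum_fps chi * (1 - ?q * fps_X)\<^sup>2 * ?D
      = (?Z 1 * (1 - ?q * fps_X))\<^sup>2 * (?N 1 * ?D * ?C)"
    unfolding F principal_fps[OF zero_less_one] by (simp add: power2_eq_square mult_ac)
  \<comment> \<open>Both parenthesised zeta products are \<open>1\<close>, so one may replace the
    other; the new one combines with \<open>?N 2 * ?C\<close> into the product of the
    L-series.\<close>
  also have "\<dots> = (?Z 2 * (1 - ?q * fps_X ^ 2)) * (?N 2 * ?C)"
    unfolding Z1 Z2 N2 by simp
  also have "\<dots> = (1 - ?q * fps_X ^ 2) * (L_fps chi * L_fps (\<lambda>f. cnj (chi f)))"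
    unfolding LL by (subst principal_fps) (simp_all add: mult_ac)
  finally show ?thesis .
qed

lemma sum_character_residues:
  assumes "chi \<in> nonprincipal_characters Q"
  shows "(\<Sum>h | h mod Q = h. chi h) = 0"
proof -
  have chi: "dirichlet_character Q chi" "chi \<noteq> principal_character Q"
    using assms by (auto simp: nonprincipal_characters_def)
  have "(\<Sum>h | h mod Q = h. chi h) = (\<Sum>h\<in>R. chi h)"
    by (rule sum.mono_neutral_right[OF finite_residues])
       (use character_eq_0_iff[OF chi(1)] in \<open>auto simp: reduced_residues_def\<close>)
  then show ?thesis using sum_character_reduced[OF chi(1)] chi(2) by simp
qed

text \<open>For \<open>n \<ge> deg Q\<close>, shifting by a residue permutes the monic polynomials of degree \<open>n\<close>; averaging
  over all shifts replaces each value of the character by its mean over the residues.\<close>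

lemma L_fps_vanishes:
  assumes chi: "chi \<in> nonprincipal_characters Q" and n: "n \<ge> degree Q"
  shows "fps_nth (L_fps chi) n = 0"
proof -
  let ?M = "{f :: 'a poly. is_monic f \<and> degree f = n}" and ?R = "{h. h mod Q = h}"
  have per: "dirichlet_character Q chi" using chi by (simp add: nonprincipal_characters_def)
  have shift: "f + h \<in> ?M" if "f \<in> ?M" "degree h < n \<or> h = 0" for f h
    using that by (auto simp: degree_add_eq_left coeff_eq_0)
  show ?thesis
  proof (cases "degree Q = 0")
    \<comment> \<open>For constant \<open>Q\<close> the only residue \<open>0\<close> is coprime to
      \<open>Q\<close>, so \<open>chi 0 = 0\<close> is a contradiction: there is no nonprincipal
      character.\<close>
    case True
    then have "is_unit Q" using Q_nonzero by (simp add: is_unit_iff_degree)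
    then have "?R = {0}" using unit_imp_dvd[of Q] by (auto simp: dvd_imp_mod_0)
    then have "chi 0 = 0" using sum_character_residues[OF chi] by simp
    then show ?thesis
      using character_eq_0_iff[OF per, of 0] \<open>is_unit Q\<close> by simp
  next
    case False
    have deg: "degree h < n \<or> h = 0" if "h \<in> ?R" for h
      using that n degree_mod_less[OF Q_nonzero, of h] by auto
    have fin: "finite ?M" by simp
    have "of_nat (card ?R) * (\<Sum>f\<in>?M. chi f) = (\<Sum>h\<in>?R. \<Sum>f\<in>?M. chi f)" by simp
    also have "\<dots> = (\<Sum>h\<in>?R. \<Sum>f\<in>?M. chi (f + h))"
    proof (rule sum.cong[OF refl])
      fix h assume h: "h \<in> ?R"
      have "bij_betw (\<lambda>f. f + h) ?M ?M"
        by (rule bij_betw_byWitness[where f' = "\<lambda>f. f + (- h)"])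
           (use deg[OF h] shift[of _ h] shift[of _ "- h"] in \<open>auto simp: coeff_eq_0\<close>)
      from sum.reindex_bij_betw[OF this, of chi]
      show "(\<Sum>f\<in>?M. chi f) = (\<Sum>f\<in>?M. chi (f + h))" by simp
    qed
    also have "\<dots> = (\<Sum>f\<in>?M. \<Sum>h\<in>?R. chi (f + h))" by (rule sum.swap)
    also have "\<dots> = (\<Sum>f\<in>?M. \<Sum>h\<in>?R. chi h)"
    proof (rule sum.cong[OF refl])
      fix f
      have "bij_betw (\<lambda>h. (f + h) mod Q) ?R ?R"
        by (rule bij_betw_byWitness[where f' = "\<lambda>h. (h - f) mod Q"])
           (auto simp: mod_diff_left_eq mod_add_right_eq)
      from sum.reindex_bij_betw[OF this, of chi]
      show "(\<Sum>h\<in>?R. chi (f + h)) = (\<Sum>h\<in>?R. chi h)" by (simp add: character_mod[OF per])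
    qed
    also have "\<dots> = 0" using sum_character_residues[OF chi] by simp
    finally have "of_nat (card ?R) * (\<Sum>f\<in>?M. chi f) = 0" .
    moreover have "card ?R \<noteq> 0" using finite_residues by (auto intro: exI[of _ 0])
    ultimately show ?thesis by (simp add: gen_fps_nth)
  qed
qed

end

subsection \<open>Coefficients of a power series with a double pole\<close>

lemma fps_mult_one_minus_const_X_nth:
  fixes f :: "'a::comm_ring_1 fps"
  shows "fps_nth (f * (1 - fps_const c * fps_X)) n
    = fps_nth f n - (if n = 0 then 0 else c * fps_nth f (n - 1))"
proof -
  have "f * (1 - fps_const c * fps_X) = f - fps_const c * (fps_X * f)"
    by (simp add: algebra_simps)
  then show ?thesis by simp
qed

lemma fps_inverse_square_geometric:
  fixes c :: "'a::comm_ring_1"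
  shows "Abs_fps (\<lambda>n. of_nat (Suc n) * c ^ n) * (1 - fps_const c * fps_X)\<^sup>2 = 1"
proof -
  let ?G = "Abs_fps (\<lambda>n. c ^ n)"
  have 1: "?G * (1 - fps_const c * fps_X) = 1"
    by (rule fps_ext) (auto simp: fps_mult_one_minus_const_X_nth simp flip: power_Suc)
  have "(\<Sum>i=0..n. c ^ i * c ^ (n - i)) = of_nat (Suc n) * c ^ n" for n
    by (simp flip: power_add)
  then have "Abs_fps (\<lambda>n. of_nat (Suc n) * c ^ n) = ?G * ?G"
    by (intro fps_ext) (simp add: fps_mult_nth del: of_nat_Suc)
  then have "Abs_fps (\<lambda>n. of_nat (Suc n) * c ^ n) * (1 - fps_const c * fps_X)\<^sup>2
      = (?G * (1 - fps_const c * fps_X)) * (?G * (1 - fps_const c * fps_X))"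
    by (simp only: power2_eq_square mult_ac)
  then show ?thesis unfolding 1 by simp
qed

text \<open>Cauchy's estimate, obtained from the boundedness of the terms of a convergent
  series.\<close>

lemma fps_nth_bound_of_conv_radius:
  fixes f :: "complex fps"
  assumes "0 < r" "ereal r < fps_conv_radius f"
  obtains K where "K \<ge> 0" "\<And>n. norm (fps_nth f n) \<le> K / r ^ n"
proof -
  have "summable (\<lambda>n. norm (fps_nth f n * of_real r ^ n))"
    using assms by (intro norm_summable_fps) simp
  then have "Bseq (\<lambda>n. norm (fps_nth f n * of_real r ^ n))"
    by (intro convergent_imp_Bseq) (auto simp: convergent_def dest: summable_LIMSEQ_zero)
  then obtain K where K: "K > 0" "\<And>n. norm (norm (fps_nth f n * of_real r ^ n)) \<le> K"
    by (auto simp: Bseq_def)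
  have "norm (fps_nth f n) \<le> K / r ^ n" for n
    using K(2)[of n] assms(1) by (simp add: norm_mult norm_power field_simps)
  then show ?thesis using K(1) by (intro that[of K]) auto
qed

lemma sums_of_nat_mult_fps_nth:
  fixes f :: "complex fps"
  assumes "ereal (norm z) < fps_conv_radius f"
  shows "(\<lambda>n. of_nat n * fps_nth f n * z ^ n) sums (z * eval_fps (fps_deriv f) z)"
proof -
  have "(\<lambda>n. fps_nth (fps_deriv f) n * z ^ n) sums eval_fps (fps_deriv f) z"
    using assms fps_conv_radius_deriv[of f] by (intro sums_eval_fps) (rule less_le_trans)
  from sums_mult[OF this, of z]
  have "(\<lambda>n. of_nat (Suc n) * fps_nth f (Suc n) * z ^ Suc n) sums (z * eval_fps (fps_deriv f) z)"
    by (simp add: mult_ac)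
  then show ?thesis by (subst (asm) sums_Suc_iff) simp
qed

text \<open>The coefficient of \<open>F\<close> is the sum of \<open>H_i (n+1-i) q^(n-i)\<close>
  over \<open>i \<le> n\<close>. Over all \<open>i\<close> the same expression sums to
  \<open>(n+1) q^n H(1/q) - q^(n-1) H'(1/q)\<close>, so the error is exactly the tail beyond
  \<open>n\<close>.\<close>

lemma double_pole_asymptotics:
  fixes F H :: "complex fps" and q \<epsilon> :: real
  assumes q: "q > 1" and \<epsilon>: "0 < \<epsilon>" "\<epsilon> < 1"
    and FH: "F * (1 - fps_const (of_real q) * fps_X)\<^sup>2 = H"
    and radius: "fps_conv_radius H \<ge> 1"
  shows "\<exists>C. \<forall>n. norm (fps_nth F n - (of_real ((real n + 1) * q ^ n) * eval_fps H (of_real (1 / q))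
      - of_real (q ^ n / q) * eval_fps (fps_deriv H) (of_real (1 / q)))) \<le> C * q powr (real n * \<epsilon>)"
proof -
  define z :: complex where "z = of_real (1 / q)"
  \<comment> \<open>The circle for the coefficient bound, inside the unit disc because
    \<open>\<epsilon>\<close> is positive.\<close>
  define r where "r = q powr (- \<epsilon>)"
  \<comment> \<open>The ratio of the tail: coefficients grow at most like
    \<open>q^(\<epsilon> i)\<close> against the decay \<open>q^(-i)\<close>. It is below
    \<open>1\<close> because \<open>\<epsilon> < 1\<close>.\<close>
  define x where "x = q powr \<epsilon> / q"
  have r: "0 < r" "r < 1" using q \<epsilon> by (auto simp: r_def powr_less_one)
  have "q powr \<epsilon> < q powr 1" using q \<epsilon> by (intro powr_less_mono) auto
  then have x: "0 < x" "x < 1" using q by (auto simp: x_def)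
  have "ereal r < 1" using r by (simp add: one_ereal_def)
  then obtain K where K: "K \<ge> 0" "\<And>n. norm (fps_nth H n) \<le> K / r ^ n"
    using fps_nth_bound_of_conv_radius[OF r(1), of H] radius less_le_trans by metis
  have zr: "ereal (norm z) < fps_conv_radius H"
    using q radius by (intro less_le_trans[OF _ radius]) (auto simp: z_def norm_divide one_ereal_def)
  have Fn: "fps_nth F n = (\<Sum>i<Suc n. fps_nth H i * (of_real (real n + 1 - real i) * of_real q ^ (n - i)))" for n
  proof -
    let ?G = "Abs_fps (\<lambda>n. of_nat (Suc n) * of_real q ^ n) :: complex fps"
    have "F = F * (?G * (1 - fps_const (of_real q) * fps_X)\<^sup>2)"
      by (simp only: fps_inverse_square_geometric mult_1_right)
    also have "\<dots> = H * ?G" unfolding FH[symmetric] by (simp only: mult_ac)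
    finally show ?thesis
      by (simp add: fps_mult_nth atLeast0AtMost lessThan_Suc_atMost algebra_simps of_nat_diff)
  qed
  show ?thesis
  proof (intro exI allI)
    fix n
    let ?S = "of_real ((real n + 1) * q ^ n) * eval_fps H z - of_real (q ^ n / q) * eval_fps (fps_deriv H) z"
    \<comment> \<open>Written with \<open>z ^ i\<close> and a real difference, the summand keeps its
      meaning for \<open>i > n\<close>, where the natural subtraction in \<open>q ^ (n - i)\<close>
      would truncate.\<close>
    define g where "g i = fps_nth H i * of_real (real n + 1 - real i) * of_real (q ^ n) * z ^ i" for i
    have "(\<lambda>i. of_real ((real n + 1) * q ^ n) * (fps_nth H i * z ^ i)
        - of_real (q ^ n) * (of_nat i * fps_nth H i * z ^ i)) sums
        (of_real ((real n + 1) * q ^ n) * eval_fps H z - of_real (q ^ n) * (z * eval_fps (fps_deriv H) z))"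
      by (intro sums_diff sums_mult sums_eval_fps sums_of_nat_mult_fps_nth zr)
    also have "(\<lambda>i. of_real ((real n + 1) * q ^ n) * (fps_nth H i * z ^ i)
        - of_real (q ^ n) * (of_nat i * fps_nth H i * z ^ i)) = g"
      by (rule ext) (simp add: g_def algebra_simps)
    finally have g: "g sums ?S" by (simp add: z_def)
    have "g i = fps_nth H i * (of_real (real n + 1 - real i) * of_real q ^ (n - i))" if "i < Suc n" for i
    proof -
      have "of_real q ^ n * z ^ i = (of_real q ^ (n - i) :: complex)"
        using that q by (simp add: z_def power_diff power_divide field_simps)
      then show ?thesis by (simp add: g_def mult.assoc)
    qed
    then have "fps_nth F n = (\<Sum>i<Suc n. g i)" unfolding Fn by (intro sum.cong) auto
    then have "(\<lambda>i. g (i + Suc n)) sums (?S - fps_nth F n)"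
      using sums_split_initial_segment[OF g, of "Suc n"] by simp
    moreover have "(\<lambda>i. K * q powr (real n * \<epsilon>) * x * (real (Suc i) * x ^ i)) sums
        (K * q powr (real n * \<epsilon>) * x * (1 / (1 - x)\<^sup>2))"
      using x by (intro sums_mult geometric_deriv_sums) auto
    moreover have "norm (g (i + Suc n)) \<le> K * q powr (real n * \<epsilon>) * x * (real (Suc i) * x ^ i)" for i
    proof -
      let ?j = "i + Suc n"
      \<comment> \<open>At index \<open>i + Suc n\<close> the factor \<open>n + 1 - index\<close> is
        \<open>- i\<close>; it is then bounded by \<open>Suc i\<close> to match the derivative of
        the geometric series.\<close>
      have "norm (g ?j) = norm (fps_nth H ?j) * real i * (q ^ n * (1 / q) ^ ?j)"
        using q by (simp add: g_def z_def norm_mult norm_power norm_divide del: of_real_add of_real_diff)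
      also have "\<dots> \<le> K / r ^ ?j * real (Suc i) * (q ^ n * (1 / q) ^ ?j)"
        using K(1) q r by (intro mult_mono K(2)) auto
      also have "\<dots> = K * real (Suc i) * ((1 / r) ^ ?j * (q ^ n * (1 / q) ^ ?j))"
        by (simp add: power_divide field_simps)
      also have "(1 / r) ^ ?j * (q ^ n * (1 / q) ^ ?j) = (q powr \<epsilon>) ^ n * x ^ Suc i"
        using q by (simp add: r_def x_def powr_minus power_add power_divide field_simps)
      also have "(q powr \<epsilon>) ^ n = q powr (real n * \<epsilon>)"
        using q by (simp add: powr_powr mult.commute flip: powr_realpow)
      finally show ?thesis by (simp add: mult_ac)
    qed
    ultimately have "norm (?S - fps_nth F n) \<le> K * q powr (real n * \<epsilon>) * x * (1 / (1 - x)\<^sup>2)"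
      by (rule norm_sums_le)
    then show "norm (fps_nth F n - (of_real ((real n + 1) * q ^ n) * eval_fps H (of_real (1 / q))
      - of_real (q ^ n / q) * eval_fps (fps_deriv H) (of_real (1 / q))))
        \<le> K * x / (1 - x)\<^sup>2 * q powr (real n * \<epsilon>)"
      by (subst norm_minus_commute) (simp add: z_def mult_ac)
  qed
qed

subsection \<open>The principal part at \<open>u = 1/q\<close>\<close>

lemma fps_conv_radius_infinity:
  fixes f g :: "'b::{banach, real_normed_div_algebra, comm_ring_1} fps"
  assumes "fps_conv_radius f = \<infinity>" "fps_conv_radius g = \<infinity>"
  shows "fps_conv_radius (f + g) = \<infinity>" "fps_conv_radius (f - g) = \<infinity>" "fps_conv_radius (f * g) = \<infinity>"
  using fps_conv_radius_add[of f g] fps_conv_radius_diff[of f g] fps_conv_radius_mult[of f g] assms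
  by auto

lemma eval_fps_prod_entire:
  fixes f :: "'b \<Rightarrow> complex fps"
  assumes "finite S" "\<And>x. x \<in> S \<Longrightarrow> fps_conv_radius (f x) = \<infinity>"
  shows "fps_conv_radius (\<Prod>x\<in>S. f x) = \<infinity> \<and>
    eval_fps (\<Prod>x\<in>S. f x) z = (\<Prod>x\<in>S. eval_fps (f x) z)"
  using assms by (induction S) (auto simp: fps_conv_radius_infinity eval_fps_mult)

lemma eval_fps_cnj:
  fixes f g :: "complex fps"
  assumes "\<And>n. fps_nth g n = cnj (fps_nth f n)" "fps_conv_radius f = \<infinity>"
  shows "eval_fps g (of_real x) = cnj (eval_fps f (of_real x))"
proof -
  have "(\<lambda>n. fps_nth f n * of_real x ^ n) sums eval_fps f (of_real x)"
    using assms(2) by (intro sums_eval_fps) simp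
  then have "(\<lambda>n. cnj (fps_nth f n * of_real x ^ n)) sums cnj (eval_fps f (of_real x))"
    by (simp only: sums_cnj)
  then show ?thesis
    unfolding eval_fps_def by (simp add: assms(1) sums_iff)
qed

text \<open>On degree \<open>n\<close> the factor \<open>|f|^(-s)\<close> is the constant
  \<open>(q^(-s))^n\<close>, so the two series agree term by term.\<close>

lemma L_function_eq_eval_fps:
  fixes chi :: "'a::{finite,field} poly \<Rightarrow> complex"
  shows "L_function chi s = eval_fps (L_fps chi) (exp (- s * of_real (ln (real CARD('a)))))"
proof -
  let ?q = "real CARD('a)"
  have "complex_of_real (abs_poly f) powr (- s) = exp (- s * of_real (ln ?q)) ^ n"
    if "degree f = n" for f :: "'a poly" and n
  proof -
    have "complex_of_real (abs_poly f) powr (- s) = exp (- s * of_real (ln (?q ^ n)))"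
      using that by (simp add: abs_poly_def powr_def Ln_of_real flip: of_real_power)
    also have "\<dots> = exp (of_nat n * (- s * of_real (ln ?q)))"
      by (simp add: ln_realpow mult_ac)
    finally show ?thesis by (simp only: exp_of_nat_mult)
  qed
  then have "(\<Sum>f | is_monic f \<and> degree f = n. chi f * complex_of_real (abs_poly f) powr (- s))
      = fps_nth (L_fps chi) n * exp (- s * of_real (ln ?q)) ^ n" for n
    by (simp add: gen_fps_nth sum_distrib_right)
  then show ?thesis by (simp add: L_function_def eval_fps_def)
qed

section \<open>L-values and local factors, with \<open>q\<close> as a real parameter\<close>

locale poly_modulus_card = poly_modulus Q for Q :: "'a::{finite,field} poly" +
  fixes q :: real
  assumes q_eq: "q = real CARD('a)"
begin

lemma q_gt_1: "q > 1"
proof -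
  have "card {0, 1 :: 'a} \<le> CARD('a)" by (rule card_mono) auto
  then show ?thesis by (simp add: q_eq)
qed

lemma abs_poly_eq: "abs_poly (f :: 'a poly) = q ^ degree f"
  by (simp add: abs_poly_def q_eq)

lemma of_nat_card_fps: "(of_nat CARD('a) :: complex fps) = fps_const (of_real q)"
  by (simp add: q_eq fps_of_nat)

lemma L_function_eq: "L_function (chi :: 'a poly \<Rightarrow> complex) s = eval_fps (L_fps chi) (exp (- s * of_real (ln q)))"
  unfolding q_eq by (rule L_function_eq_eval_fps)

lemma L_fps_radius:
  assumes "chi \<in> nonprincipal_characters Q"
  shows "fps_conv_radius (L_fps chi) = \<infinity>"
  unfolding fps_conv_radius_def
proof (rule conv_radius_inftyI'')
  fix z :: complex
  show "summable (\<lambda>n. fps_nth (L_fps chi) n * z ^ n)"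
    using L_fps_vanishes[OF assms] by (intro summable_finite[of "{..<degree Q}"]) auto
qed

lemma cnj_L_fps_nth: "fps_nth (L_fps (\<lambda>f. cnj (chi f))) n = cnj (fps_nth (L_fps chi) n)"
  by (simp add: gen_fps_nth)

lemma L_function_at_1:
  "L_function chi 1 = eval_fps (L_fps (chi :: 'a poly \<Rightarrow> complex)) (of_real (1 / q))"
  using q_gt_1 by (simp add: L_function_eq exp_minus exp_of_real inverse_eq_divide)

text \<open>Chain rule for \<open>u = q^(-s)\<close>, whose derivative is \<open>- ln q * u\<close>.
  The logarithm in \<open>B_coeff\<close> converts between the two variables.\<close>

lemma deriv_L_function_at_1:
  assumes "chi \<in> nonprincipal_characters Q"
  shows "deriv (L_function chi) 1
    = - of_real (ln q / q) * eval_fps (fps_deriv (L_fps chi)) (of_real (1 / q))"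
proof -
  let ?e = "\<lambda>s :: complex. exp (- s * of_real (ln q))"
  have e: "?e 1 = of_real (1 / q)"
    using q_gt_1 by (simp add: exp_minus exp_of_real inverse_eq_divide)
  have "(?e has_field_derivative (- of_real (ln q) * ?e 1)) (at 1)"
    by (auto intro!: derivative_eq_intros)
  moreover have "(eval_fps (L_fps chi) has_field_derivative eval_fps (fps_deriv (L_fps chi)) (?e 1)) (at (?e 1))"
    by (rule has_field_derivative_eval_fps) (simp add: L_fps_radius[OF assms])
  ultimately have "((\<lambda>s. eval_fps (L_fps chi) (?e s)) has_field_derivative
      eval_fps (fps_deriv (L_fps chi)) (?e 1) * (- of_real (ln q) * ?e 1)) (at 1)"
    by (rule DERIV_chain2[rotated])
  then have "(L_function chi has_field_derivative
      eval_fps (fps_deriv (L_fps chi)) (of_real (1 / q)) * (- of_real (ln q) * of_real (1 / q))) (at 1)"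
    unfolding e by (simp add: L_function_eq[abs_def])
  then show ?thesis by (simp add: DERIV_imp_deriv mult_ac)
qed

lemma prime_divisor_degree_pos: "P \<in> monic_prime_divisors Q \<Longrightarrow> degree P > 0"
  using is_unit_iff_degree[of P] by (auto simp: monic_prime_divisors_def irreducible_def)

definition local_fps :: "complex fps" where
  "local_fps = (\<Prod>P\<in>monic_prime_divisors Q. 1 + fps_X ^ degree P)"

definition local_value :: real where
  "local_value = (\<Prod>P\<in>monic_prime_divisors Q. 1 + 1 / abs_poly P)"

lemma abs_poly_pos: "abs_poly (f :: 'a poly) > 0"
  using q_gt_1 by (simp add: abs_poly_eq)

lemma local_value_pos: "local_value > 0"
  unfolding local_value_def by (intro prod_pos) (simp add: abs_poly_pos add_pos_pos)

lemma local_fps_radius: "fps_conv_radius local_fps = \<infinity>"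
  and eval_local_fps: "eval_fps local_fps z = (\<Prod>P\<in>monic_prime_divisors Q. 1 + z ^ degree P)"
  using eval_fps_prod_entire[of "monic_prime_divisors Q" "\<lambda>P. 1 + fps_X ^ degree P" z]
  by (simp_all add: local_fps_def fps_conv_radius_infinity eval_fps_add)

text \<open>A zero of \<open>1 + z^d\<close> with \<open>d > 0\<close> has modulus \<open>1\<close>.
  Hence the inverse of \<open>local_fps\<close> converges in the unit disc.\<close>

lemma eval_local_fps_nonzero:
  assumes "norm z < 1"
  shows "eval_fps local_fps z \<noteq> 0"
proof -
  have "1 + z ^ degree P \<noteq> 0" if "P \<in> monic_prime_divisors Q" for P
  proof
    assume "1 + z ^ degree P = 0"
    then have "z ^ degree P = -1" by (simp add: add_eq_0_iff)
    then have "norm z ^ degree P = 1" by (metis norm_minus_cancel norm_one norm_power)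
    then show False
      using assms prime_divisor_degree_pos[OF that] power_eq_1_iff[of "norm z" "degree P"] by auto
  qed
  then show ?thesis by (simp add: eval_local_fps)
qed

lemma local_value: "eval_fps local_fps (of_real (1 / q)) = of_real local_value"
  by (simp add: eval_local_fps local_value_def abs_poly_eq power_divide)

text \<open>Logarithmic differentiation of the product, with \<open>deg P\<close> rewritten as
  \<open>ln |P| / ln q\<close>.\<close>

lemma eval_deriv_local_fps:
  "eval_fps (fps_deriv local_fps) (of_real (1 / q)) =
    of_real (local_value * (q / ln q * (\<Sum>P\<in>monic_prime_divisors Q. ln (abs_poly P) / (abs_poly P + 1))))"
proof -
  let ?u = "of_real (1 / q) :: complex" and ?S = "monic_prime_divisors Q"
  have u: "norm ?u < 1" using q_gt_1 by (simp add: norm_divide)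
  have nz: "1 + ?u ^ degree P = of_real (1 + 1 / abs_poly P)" for P :: "'a poly"
    by (simp add: abs_poly_eq power_divide)
  have nz': "1 + 1 / abs_poly P \<noteq> 0" for P :: "'a poly"
    using abs_poly_pos[of P] by (simp add: add_pos_pos less_imp_neq[symmetric])
  have "((\<lambda>z. \<Prod>P\<in>?S. 1 + z ^ degree P) has_field_derivative
      (\<Prod>P\<in>?S. 1 + ?u ^ degree P) * (\<Sum>P\<in>?S. of_nat (degree P) * ?u ^ (degree P - 1) / (1 + ?u ^ degree P)))
      (at ?u)"
  proof (rule has_field_derivative_prod')
    show "1 + ?u ^ degree P \<noteq> 0" for P :: "'a poly"
      unfolding nz of_real_eq_0_iff by (rule nz')
  qed (auto intro!: derivative_eq_intros)
  also have "(\<lambda>z. \<Prod>P\<in>?S. 1 + z ^ degree P) = eval_fps local_fps"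
    by (simp add: eval_local_fps fun_eq_iff)
  finally have "eval_fps (fps_deriv local_fps) ?u = eval_fps local_fps ?u *
      (\<Sum>P\<in>?S. of_nat (degree P) * ?u ^ (degree P - 1) / (1 + ?u ^ degree P))"
    by (rule DERIV_unique[rotated, OF _ has_field_derivative_eval_fps]) (simp add: local_fps_radius)
  also have "eval_fps local_fps ?u = of_real local_value" by (rule local_value)
  also have "(\<Sum>P\<in>?S. of_nat (degree P) * ?u ^ (degree P - 1) / (1 + ?u ^ degree P))
      = (\<Sum>P\<in>?S. of_real (q / ln q * (ln (abs_poly P) / (abs_poly P + 1))))"
  proof (rule sum.cong[OF refl])
    fix P assume P: "P \<in> ?S"
    have "?u ^ degree P = ?u * ?u ^ (degree P - 1)"
      using prime_divisor_degree_pos[OF P] by (simp flip: power_Suc)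
    \<comment> \<open>The exponent \<open>degree P - 1\<close> is a genuine difference only because
      primes have positive degree.\<close>
    then have X: "?u ^ (degree P - 1) = of_real (q / abs_poly P)"
      using q_gt_1 by (simp add: abs_poly_eq power_divide field_simps)
    have "of_nat (degree P) * ?u ^ (degree P - 1) / (1 + ?u ^ degree P)
        = of_real (degree P * (q / abs_poly P) / (1 + 1 / abs_poly P))"
      unfolding nz X by (simp only: of_real_mult of_real_divide of_real_of_nat_eq)
    also have "degree P * (q / abs_poly P) / (1 + 1 / abs_poly P) = q * degree P / (abs_poly P + 1)"
      using abs_poly_pos[of P] by (simp add: field_simps)
    also have "\<dots> = q / ln q * (ln (abs_poly P) / (abs_poly P + 1))"
      using q_gt_1 by (simp add: abs_poly_eq ln_realpow)
    finally show "of_nat (degree P) * ?u ^ (degree P - 1) / (1 + ?u ^ degree P)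
        = of_real (q / ln q * (ln (abs_poly P) / (abs_poly P + 1)))" .
  qed
  finally show ?thesis by (simp only: of_real_mult of_real_sum sum_distrib_left)
qed

text \<open>The share of a single character in \<open>A_coeff Q\<close>, before division by the
  square of \<open>Phi Q\<close>; likewise \<open>B_term\<close> below.\<close>

definition A_term :: "('a poly \<Rightarrow> complex) \<Rightarrow> real" where
  "A_term chi = (q - 1) / q\<^sup>2 / local_value * (cmod (L_function chi 1))\<^sup>2"

definition B_term :: "('a poly \<Rightarrow> complex) \<Rightarrow> real" where
  "B_term chi = 1 / local_value / q\<^sup>2 *
     (((q - 1) / ln q * (\<Sum>P\<in>monic_prime_divisors Q. ln (abs_poly P) / (abs_poly P + 1)) + 2)
        * (cmod (L_function chi 1))\<^sup>2
      + 2 * (q - 1) / ln q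
        * ((cmod (L_function chi 1))\<^sup>2 * Re (deriv (L_function chi) 1 / L_function chi 1)))"

lemma norm_divisor_sum_asymptotics:
  assumes chi: "chi \<in> nonprincipal_characters Q" and \<epsilon>: "0 < \<epsilon>" "\<epsilon> < 1"
  shows "\<exists>C. \<forall>n. \<bar>(\<Sum>f | is_monic f \<and> degree f = n. (cmod (divisor_sum chi f))\<^sup>2)
    - (A_term chi * (real n + 1) * q ^ (n + 1) + B_term chi * q ^ (n + 1))\<bar> \<le> C * q powr (real n * \<epsilon>)"
proof -
  define u :: complex where "u = of_real (1 / q)"
  define l where "l = L_fps chi"
  define lb where "lb = L_fps (\<lambda>f. cnj (chi f))"
  define N where "N = (1 - fps_const (of_real q) * fps_X ^ 2) * (l * lb)"
  define H where "H = N * inverse local_fps"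
  define w where "w = (cmod (eval_fps l u))\<^sup>2"
  \<comment> \<open>Takes the place of \<open>w * Re (L'/L)\<close> and involves no division, so it
    is meaningful also when the L-value is zero.\<close>
  define \<rho> where "\<rho> = Re (eval_fps (fps_deriv l) u * cnj (eval_fps l u))"
  define T where "T = (\<Sum>P\<in>monic_prime_divisors Q. ln (abs_poly P) / (abs_poly P + 1))"
  have per: "dirichlet_character Q chi" using chi by (simp add: nonprincipal_characters_def)
  have u1: "norm u < 1" using q_gt_1 by (simp add: u_def norm_divide)
  have qu: "of_real q * u = 1" using q_gt_1 by (simp add: u_def)
  have l_rad: "fps_conv_radius l = \<infinity>" unfolding l_def by (rule L_fps_radius[OF chi])
  then have lb_rad: "fps_conv_radius lb = \<infinity>"
    using conv_radius_cong[of "\<lambda>n. fps_nth lb n" "\<lambda>n. fps_nth l n"]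
    by (simp add: fps_conv_radius_def lb_def l_def cnj_L_fps_nth)
  have deriv_rad: "fps_conv_radius (fps_deriv f) = \<infinity>" if "fps_conv_radius f = \<infinity>" for f :: "complex fps"
    using fps_conv_radius_deriv[of f] that by simp
  have zeta_rad: "fps_conv_radius (1 - fps_const (of_real q) * fps_X ^ 2 :: complex fps) = \<infinity>"
    by (simp add: fps_conv_radius_infinity)
  have N_rad: "fps_conv_radius N = \<infinity>"
    unfolding N_def by (intro fps_conv_radius_infinity l_rad lb_rad zeta_rad)
  have "fps_conv_radius (inverse local_fps) \<ge> min 1 (fps_conv_radius local_fps)"
    by (rule fps_conv_radius_inverse) (use eval_local_fps_nonzero in \<open>simp add: one_ereal_def\<close>)
  then have inv_rad: "fps_conv_radius (inverse local_fps) \<ge> 1"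
    using local_fps_radius by simp
  then have H_rad: "fps_conv_radius H \<ge> 1"
    unfolding H_def using fps_conv_radius_mult[of N "inverse local_fps"] N_rad by (metis min_top2 top_ereal_def min.commute order_trans)
  have "fps_nth local_fps 0 \<noteq> 0"
    using eval_local_fps_nonzero[of 0] by (simp add: eval_fps_at_0)
  then have inv: "local_fps * inverse local_fps = 1" by (rule inverse_mult_eq_1')
  have HD: "H * local_fps = N" unfolding H_def using inv by (simp add: mult_ac)
  have "norm_divisor_sum_fps chi * (1 - fps_const (of_real q) * fps_X)\<^sup>2 * local_fps = N"
    using norm_divisor_sum_fps_eq[OF per]
    by (simp add: N_def l_def lb_def local_fps_def of_nat_card_fps)
  then have FH: "norm_divisor_sum_fps chi * (1 - fps_const (of_real q) * fps_X)\<^sup>2 = H"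
    unfolding H_def using inv by (metis mult.assoc mult_1_right)
  have lb: "eval_fps lb u = cnj (eval_fps l u)"
    unfolding u_def by (rule eval_fps_cnj[OF _ l_rad]) (simp add: l_def lb_def cnj_L_fps_nth)
  have lb': "eval_fps (fps_deriv lb) u = cnj (eval_fps (fps_deriv l) u)"
    unfolding u_def by (rule eval_fps_cnj[OF _ deriv_rad[OF l_rad]]) (simp add: l_def lb_def cnj_L_fps_nth)
  have Hu: "norm u < fps_conv_radius H"
    using u1 H_rad by (intro less_le_trans[OF _ H_rad]) (simp add: one_ereal_def)
  have H'u: "norm u < fps_conv_radius (fps_deriv H)"
    using Hu fps_conv_radius_deriv[of H] by (rule less_le_trans)
  have zeta_u: "eval_fps (1 - fps_const (of_real q) * fps_X ^ 2) u = of_real (1 - 1 / q)"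
  proof -
    have "eval_fps (1 - fps_const (of_real q) * fps_X ^ 2) u = 1 - of_real q * u * u"
      by (simp add: eval_fps_diff eval_fps_mult fps_conv_radius_infinity power2_eq_square mult_ac)
    then show ?thesis using qu by (simp add: u_def)
  qed
  have ww: "eval_fps l u * cnj (eval_fps l u) = of_real w"
    by (simp only: w_def complex_norm_square)
  have "eval_fps N u = of_real ((1 - 1 / q) * w)"
    by (simp add: N_def eval_fps_mult zeta_rad l_rad lb_rad fps_conv_radius_infinity zeta_u lb ww)
  moreover have "eval_fps H u * of_real local_value = eval_fps N u"
    unfolding HD[symmetric] using Hu by (simp add: eval_fps_mult local_fps_radius local_value[folded u_def])
  ultimately have h: "eval_fps H u = of_real ((1 - 1 / q) * w / local_value)"
    using local_value_pos by (simp add: field_simps)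
  \<comment> \<open>The derivative of \<open>1 - q u^2\<close> is \<open>-2\<close> at
    \<open>u = 1/q\<close>, the source of the summand \<open>2\<close> in \<open>B_coeff\<close>.
    The derivative of the L-product is a number plus its conjugate, hence
    \<open>2 * \<rho>\<close>.\<close>
  have N': "eval_fps (fps_deriv N) u = of_real (2 * (1 - 1 / q) * \<rho> - 2 * w)"
  proof -
    have "fps_deriv N = - (fps_const (of_real (2 * q)) * fps_X) * (l * lb)
        + (1 - fps_const (of_real q) * fps_X ^ 2) * (fps_deriv l * lb + l * fps_deriv lb)"
      by (simp add: N_def algebra_simps power2_eq_square flip: fps_const_mult)
    then have "eval_fps (fps_deriv N) u = - (of_real (2 * q) * u) * (eval_fps l u * eval_fps lb u)
        + of_real (1 - 1 / q) * (eval_fps (fps_deriv l) u * eval_fps lb u + eval_fps l u * eval_fps (fps_deriv lb) u)"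
      by (simp add: eval_fps_add eval_fps_diff eval_fps_minus eval_fps_mult zeta_rad l_rad lb_rad deriv_rad fps_conv_radius_infinity zeta_u)
    also have "of_real (2 * q) * u = 2" using qu by simp
    also have "eval_fps l u * eval_fps lb u = of_real w"
      by (simp only: lb ww)
    also have "eval_fps (fps_deriv l) u * eval_fps lb u + eval_fps l u * eval_fps (fps_deriv lb) u = of_real (2 * \<rho>)"
      using complex_add_cnj[of "eval_fps (fps_deriv l) u * cnj (eval_fps l u)"]
      by (simp add: lb lb' \<rho>_def mult.commute)
    finally show ?thesis by (simp add: algebra_simps)
  qed
  \<comment> \<open>The quotient rule is obtained by differentiating
    \<open>H * local_fps = N\<close>, so the derivative of the inverse series never appears.\<close>
  have "fps_deriv H * local_fps + H * fps_deriv local_fps = fps_deriv N"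
    unfolding HD[symmetric] by simp
  moreover have "norm u < fps_conv_radius (fps_deriv H * local_fps)"
    "norm u < fps_conv_radius (H * fps_deriv local_fps)"
    using Hu H'u by (auto intro!: less_le_trans[OF _ fps_conv_radius_mult]
        simp: local_fps_radius deriv_rad)
  ultimately have "eval_fps (fps_deriv H) u * of_real local_value
      + eval_fps H u * of_real (local_value * (q / ln q * T)) = eval_fps (fps_deriv N) u"
    using Hu H'u local_value[folded u_def] eval_deriv_local_fps[folded u_def T_def]
      eval_fps_add[of u "fps_deriv H * local_fps" "H * fps_deriv local_fps"]
    by (simp add: eval_fps_mult local_fps_radius deriv_rad)
  then have h': "eval_fps (fps_deriv H) u
      = of_real ((2 * (1 - 1 / q) * \<rho> - 2 * w - (1 - 1 / q) * w * (q / ln q * T)) / local_value)"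
  proof -
    let ?X = "eval_fps (fps_deriv H) u" and ?n = "2 * (1 - 1 / q) * \<rho> - 2 * w"
    let ?t = "q / ln q * T"
    assume "?X * of_real local_value + eval_fps H u * of_real (local_value * ?t) = eval_fps (fps_deriv N) u"
    then have "?X * of_real local_value
        = of_real ?n - of_real ((1 - 1 / q) * w / local_value) * of_real (local_value * ?t)"
      unfolding N' h by (simp only: eq_diff_eq)
    also have "\<dots> = of_real (?n - (1 - 1 / q) * w / local_value * (local_value * ?t))"
      by (simp only: of_real_mult of_real_diff)
    also have "(1 - 1 / q) * w / local_value * (local_value * ?t) = (1 - 1 / q) * w * ?t"
      using local_value_pos by simp
    finally show ?thesis
      using local_value_pos by (simp only: of_real_divide nonzero_eq_divide_eq of_real_eq_0_iff)
  qed
  have L1: "L_function chi 1 = eval_fps l u" by (simp add: L_function_at_1 l_def u_def)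
  \<comment> \<open>Away from zero the quotient is extended by the conjugate of the L-value, giving
    denominator \<open>w\<close>. At a zero both \<open>w\<close> and \<open>\<rho>\<close>
    vanish.\<close>
  have "w * Re (deriv (L_function chi) 1 / L_function chi 1) = - (ln q / q) * \<rho>"
  proof (cases "eval_fps l u = 0")
    case False
    have "deriv (L_function chi) 1 / L_function chi 1
        = deriv (L_function chi) 1 * cnj (L_function chi 1) / of_real w"
      unfolding w_def L1 using False by (simp add: complex_norm_square del: of_real_power)
    also have "\<dots> = of_real (- (ln q / q) / w) * (eval_fps (fps_deriv l) u * cnj (eval_fps l u))"
      by (simp add: deriv_L_function_at_1[OF chi, folded l_def u_def] L1)
    finally have "Re (deriv (L_function chi) 1 / L_function chi 1) = (- (ln q / q) / w) * \<rho>"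
      by (simp only: \<rho>_def times_complex.sel Re_complex_of_real Im_complex_of_real mult_zero_left diff_zero)
    moreover have "w \<noteq> 0" using False by (simp add: w_def)
    ultimately show ?thesis by simp
  qed (simp add: w_def \<rho>_def)
  then have B: "B_term chi = 1 / local_value / q\<^sup>2 *
      (((q - 1) / ln q * T + 2) * w + 2 * (q - 1) / ln q * (- (ln q / q) * \<rho>))"
    unfolding B_term_def L1 by (simp add: T_def w_def)
  have A: "A_term chi = (q - 1) / q\<^sup>2 / local_value * w"
    by (simp add: A_term_def L1 w_def)
  have main: "of_real ((real n + 1) * q ^ n) * eval_fps H u - of_real (q ^ n / q) * eval_fps (fps_deriv H) u
      = of_real (A_term chi * (real n + 1) * q ^ (n + 1) + B_term chi * q ^ (n + 1))" for n
  proof -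
    \<comment> \<open>Clearing denominators needs \<open>ln q\<close> nonzero. The shift from
      \<open>q^n\<close> to \<open>q^(n+1)\<close> accounts for \<open>q\<^sup>2\<close> in the
      denominators, as \<open>q^n (1 - 1/q) = q^(n+1) (q-1) / q^2\<close>.\<close>
    have "ln q > 0" using q_gt_1 by simp
    then have "(real n + 1) * q ^ n * ((1 - 1 / q) * w / local_value) - q ^ n / q *
        ((2 * (1 - 1 / q) * \<rho> - 2 * w - (1 - 1 / q) * w * (q / ln q * T)) / local_value)
      = A_term chi * (real n + 1) * q ^ (n + 1) + B_term chi * q ^ (n + 1)"
      unfolding A B using q_gt_1 local_value_pos by (simp add: field_simps power2_eq_square)
    then show ?thesis unfolding h h' by (simp only: of_real_mult[symmetric] of_real_diff[symmetric])
  qed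
  have F: "fps_nth (norm_divisor_sum_fps chi) n
      = of_real (\<Sum>f | is_monic f \<and> degree f = n. (cmod (divisor_sum chi f))\<^sup>2)" for n
    by (simp add: norm_divisor_sum_fps_def gen_fps_nth complex_norm_square del: of_real_power)
  show ?thesis
    using double_pole_asymptotics[OF q_gt_1 \<epsilon> FH H_rad, folded u_def]
    unfolding main F by (simp only: of_real_diff[symmetric] norm_of_real)
qed

lemma A_coeff_eq: "A_coeff Q = (\<Sum>chi\<in>nonprincipal_characters Q. A_term chi) / (real (Phi Q))\<^sup>2"
  unfolding A_coeff_def Let_def A_term_def q_eq[symmetric] local_value_def sum_distrib_left[symmetric]
  by (simp add: prod_dividef)

lemma B_coeff_eq: "B_coeff Q = (\<Sum>chi\<in>nonprincipal_characters Q. B_term chi) / (real (Phi Q))\<^sup>2"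
proof -
  have "(\<Prod>P\<in>monic_prime_divisors Q. inverse (1 + 1 / abs_poly P)) = 1 / local_value"
    by (simp add: local_value_def prod_dividef inverse_eq_divide)
  then show ?thesis
    unfolding B_coeff_def Let_def B_term_def q_eq[symmetric]
    by (simp only: sum_distrib_left[symmetric] sum.distrib) simp
qed

lemma sum_tau_variance_asymptotics:
  assumes \<epsilon>: "0 < \<epsilon>" "\<epsilon> < 1"
  shows "\<exists>C. \<forall>n. \<bar>(\<Sum>f | is_monic f \<and> degree f = n. tau_variance f Q)
    - (A_coeff Q * (real n + 1) * q ^ (n + 1) + B_coeff Q * q ^ (n + 1))\<bar> \<le> C * q powr (real n * \<epsilon>)"
proof -
  let ?X = "nonprincipal_characters Q" and ?P = "(real (Phi Q))\<^sup>2"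
  define E where "E chi n = (\<Sum>f | is_monic f \<and> degree f = n. (cmod (divisor_sum chi f))\<^sup>2)
    - (A_term chi * (real n + 1) * q ^ (n + 1) + B_term chi * q ^ (n + 1))" for chi n
  have "\<forall>chi\<in>?X. \<exists>C. \<forall>n. \<bar>E chi n\<bar> \<le> C * q powr (real n * \<epsilon>)"
    unfolding E_def using norm_divisor_sum_asymptotics[OF _ \<epsilon>] by blast
  \<comment> \<open>Each character has its own constant; choosing them simultaneously lets the final
    constant be their sum over \<open>(Phi Q)^2\<close>.\<close>
  from bchoice[OF this] obtain C
    where C: "\<And>chi n. chi \<in> ?X \<Longrightarrow> \<bar>E chi n\<bar> \<le> C chi * q powr (real n * \<epsilon>)"
    by blast
  show ?thesis
  proof (intro exI allI)
    fix n
    let ?M = "{f :: 'a poly. is_monic f \<and> degree f = n}"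
    have "(\<Sum>f\<in>?M. tau_variance f Q) = (\<Sum>f\<in>?M. (\<Sum>chi\<in>?X. (cmod (divisor_sum chi f))\<^sup>2) / ?P)"
      by (intro sum.cong refl tau_variance_eq) auto
    also have "\<dots> = (\<Sum>chi\<in>?X. \<Sum>f\<in>?M. (cmod (divisor_sum chi f))\<^sup>2) / ?P"
      by (subst sum.swap) (simp add: sum_divide_distrib)
    finally have "(\<Sum>f\<in>?M. tau_variance f Q)
        - (A_coeff Q * (real n + 1) * q ^ (n + 1) + B_coeff Q * q ^ (n + 1)) = (\<Sum>chi\<in>?X. E chi n) / ?P"
      by (simp add: E_def A_coeff_eq B_coeff_eq sum_subtractf sum.distrib sum_distrib_right
          add_divide_distrib diff_divide_distrib)
    also have "\<bar>\<dots>\<bar> \<le> (\<Sum>chi\<in>?X. C chi * q powr (real n * \<epsilon>)) / ?P"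
      using order_trans[OF sum_abs sum_mono[of ?X "\<lambda>chi. \<bar>E chi n\<bar>", OF C]]
      by (simp add: abs_divide divide_right_mono)
    finally show "\<bar>(\<Sum>f\<in>?M. tau_variance f Q)
        - (A_coeff Q * (real n + 1) * q ^ (n + 1) + B_coeff Q * q ^ (n + 1))\<bar>
      \<le> (\<Sum>chi\<in>?X. C chi) / ?P * q powr (real n * \<epsilon>)"
      by (simp add: sum_distrib_right)
  qed
qed

end

theorem theorem5p4:
  fixes Q :: "'a::{finite,field} poly" and \<epsilon> :: real
  assumes "Q \<noteq> 0" and "0 < \<epsilon>" and "\<epsilon> < 1"
  shows "\<exists>C::real. \<forall>n::nat.
    \<bar>(\<Sum>f | is_monic f \<and> degree f = n. tau_variance f Q)
      - (A_coeff Q * (real n + 1) * real CARD('a) ^ (n + 1)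
         + B_coeff Q * real CARD('a) ^ (n + 1))\<bar>
    \<le> C * (real CARD('a) powr (real n * \<epsilon>)
           * inverse ((real CARD('a) powr (1 - \<epsilon>) - 1)\<^sup>2))"
proof -
  let ?q = "real CARD('a)"
  interpret poly_modulus_card Q ?q by unfold_locales (use assms in auto)
  obtain C where C: "\<And>n. \<bar>(\<Sum>f | is_monic f \<and> degree f = n. tau_variance f Q)
      - (A_coeff Q * (real n + 1) * ?q ^ (n + 1) + B_coeff Q * ?q ^ (n + 1))\<bar> \<le> C * ?q powr (real n * \<epsilon>)"
    using sum_tau_variance_asymptotics[OF assms(2,3)] by blast
  define D where "D = (?q powr (1 - \<epsilon>) - 1)\<^sup>2"
  have "?q powr (1 - \<epsilon>) > 1" using q_gt_1 assms(3) by (simp add: gr_one_powr)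
  then have "D \<noteq> 0" by (simp add: D_def)
  \<comment> \<open>For fixed \<open>q\<close> and \<open>\<epsilon>\<close> the factor
    \<open>D\<close> is a positive constant independent of \<open>n\<close>, so the implied constant
    may absorb it.\<close>
  then have eq: "C * ?q powr (real n * \<epsilon>) = (C * D) * (?q powr (real n * \<epsilon>) * inverse D)" for n
    by simp
  show ?thesis
    using C unfolding eq D_def by blast
qed

end
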